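(* Weighted Biconnectivity Deletion can be solved in time $2^{O(k \log k)}n^{O(1)}$.
   Context: Weighted Biconnectivity Deletion is the following problem, parameterized by $k$. Input: a biconnected undirected graph $G$ on $n$ vertices, an integer $k\in \mathbb{N}$, a real $w^*\in \mathbb{R}_{\geq 0}$ and a weight function $w:E(G)\to \mathbb{R}_{\geq 0}$. Question: is there a set $S \subseteq E(G)$ of size at most $k$ such that $G - S$ is biconnected and $w(S) \geq w^*$? (A biconnected graph is a connected graph on two or more vertices with no cut-vertex.) *)

theory Defs
  imports Complex_Main "HOL-Library.Landau_Symbols"
begin

section \<open>Finite simple undirected graphs\<close>

definition simple_graph :: "'a set \<Rightarrow> 'a set set \<Rightarrow> bool" where
  "simple_graph V E \<longleftrightarrow> finite V \<and> (\<forall>e\<in>E. e \<subseteq> V \<and> card e = 2)"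

definition adjacency :: "'a set set \<Rightarrow> ('a \<times> 'a) set" where
  "adjacency E = {(u, v). {u, v} \<in> E}"

definition connected_graph :: "'a set \<Rightarrow> 'a set set \<Rightarrow> bool" where
  "connected_graph V E \<longleftrightarrow> V \<noteq> {} \<and> (\<forall>u\<in>V. \<forall>v\<in>V. (u, v) \<in> (adjacency E)\<^sup>*)"

definition delete_vertex :: "'a set set \<Rightarrow> 'a \<Rightarrow> 'a set set" where
  "delete_vertex E v = {e \<in> E. v \<notin> e}"

text \<open>A cut-vertex separates two other vertices of its connected component, i.e. its deletion
  increases the number of connected components.\<close>

definition cut_vertex :: "'a set \<Rightarrow> 'a set set \<Rightarrow> 'a \<Rightarrow> bool" where
  "cut_vertex V E v \<longleftrightarrow> v \<in> V \<and>
     (\<exists>x\<in>V - {v}. \<exists>y\<in>V - {v}. (x, y) \<in> (adjacency E)\<^sup>* \<and>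
        (x, y) \<notin> (adjacency (delete_vertex E v))\<^sup>*)"

definition biconnected :: "'a set \<Rightarrow> 'a set set \<Rightarrow> bool" where
  "biconnected V E \<longleftrightarrow> connected_graph V E \<and> 2 \<le> card V \<and> \<not> (\<exists>v. cut_vertex V E v)"


section \<open>Weighted Biconnectivity Deletion\<close>

text \<open>As is usual for algorithmic problems, the vertices of an input graph on \<open>n\<close> vertices
  are the numbers \<open>0, \<dots>, n - 1\<close>.\<close>

definition wbd_instance ::
    "nat \<Rightarrow> nat set set \<Rightarrow> nat \<Rightarrow> real \<Rightarrow> (nat set \<Rightarrow> real) \<Rightarrow> bool" where
  "wbd_instance n E k wstar w \<longleftrightarrow>
     simple_graph {..<n} E \<and> biconnected {..<n} E \<and> 0 \<le> wstar \<and> (\<forall>e\<in>E. 0 \<le> w e)"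

definition wbd_yes ::
    "nat \<Rightarrow> nat set set \<Rightarrow> nat \<Rightarrow> real \<Rightarrow> (nat set \<Rightarrow> real) \<Rightarrow> bool" where
  "wbd_yes n E k wstar w \<longleftrightarrow>
     (\<exists>S\<subseteq>E. card S \<le> k \<and> biconnected {..<n} (E - S) \<and> wstar \<le> (\<Sum>e\<in>S. w e))"


section \<open>A random access machine with real registers\<close>

text \<open>
  The machine is a real RAM with structured control flow. A memory consists of two infinite
  arrays, one of natural numbers (which also serve as addresses) and one of reals.
  Every operator, memory access and control step costs one unit of time.

  The operations are restricted so that unit cost is realistic. On naturals there are only
  addition and truncated subtraction (no multiplication or division), so in \<open>t\<close> steps numbers
  gain only \<open>O(t)\<close> bits. On reals there are only addition, subtraction and comparison, with no
  rounding to naturals and no real constants other than 0.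
\<close>

type_synonym memory = "(nat \<Rightarrow> nat) \<times> (nat \<Rightarrow> real)"

datatype nexp = NConst nat | NLoad nexp | NAdd nexp nexp | NSub nexp nexp

datatype rexp = RZero | RLoad nexp | RAdd rexp rexp | RSub rexp rexp

datatype bexp = NLess nexp nexp | RLess rexp rexp | BNot bexp | BAnd bexp bexp

datatype com =
    Skip
  | NStore nexp nexp
  | RStore nexp rexp
  | Seq com com
  | Ite bexp com com
  | While bexp com

primrec nval :: "nexp \<Rightarrow> memory \<Rightarrow> nat" where
  "nval (NConst c) m = c"
| "nval (NLoad a) m = fst m (nval a m)"
| "nval (NAdd a b) m = nval a m + nval b m"
| "nval (NSub a b) m = nval a m - nval b m"

primrec rval :: "rexp \<Rightarrow> memory \<Rightarrow> real" where
  "rval RZero m = 0"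
| "rval (RLoad a) m = snd m (nval a m)"
| "rval (RAdd a b) m = rval a m + rval b m"
| "rval (RSub a b) m = rval a m - rval b m"

primrec bval :: "bexp \<Rightarrow> memory \<Rightarrow> bool" where
  "bval (NLess a b) m \<longleftrightarrow> nval a m < nval b m"
| "bval (RLess a b) m \<longleftrightarrow> rval a m < rval b m"
| "bval (BNot a) m \<longleftrightarrow> \<not> bval a m"
| "bval (BAnd a b) m \<longleftrightarrow> bval a m \<and> bval b m"

primrec ncost :: "nexp \<Rightarrow> nat" where
  "ncost (NConst c) = 1"
| "ncost (NLoad a) = 1 + ncost a"
| "ncost (NAdd a b) = 1 + ncost a + ncost b"
| "ncost (NSub a b) = 1 + ncost a + ncost b"

primrec rcost :: "rexp \<Rightarrow> nat" where
  "rcost RZero = 1"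
| "rcost (RLoad a) = 1 + ncost a"
| "rcost (RAdd a b) = 1 + rcost a + rcost b"
| "rcost (RSub a b) = 1 + rcost a + rcost b"

primrec bcost :: "bexp \<Rightarrow> nat" where
  "bcost (NLess a b) = 1 + ncost a + ncost b"
| "bcost (RLess a b) = 1 + rcost a + rcost b"
| "bcost (BNot a) = 1 + bcost a"
| "bcost (BAnd a b) = 1 + bcost a + bcost b"

text \<open>\<open>runs p m t m'\<close>: started in memory \<open>m\<close>, program \<open>p\<close> halts after exactly \<open>t\<close> time units
  in memory \<open>m'\<close>.\<close>

inductive runs :: "com \<Rightarrow> memory \<Rightarrow> nat \<Rightarrow> memory \<Rightarrow> bool" where
  Skip: "runs Skip m 1 m"
| NStore: "runs (NStore a b) m (1 + ncost a + ncost b) ((fst m)(nval a m := nval b m), snd m)"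
| RStore: "runs (RStore a b) m (1 + ncost a + rcost b) (fst m, (snd m)(nval a m := rval b m))"
| Seq: "runs p m t m' \<Longrightarrow> runs q m' t' m'' \<Longrightarrow> runs (Seq p q) m (t + t') m''"
| IteTrue: "bval b m \<Longrightarrow> runs p m t m' \<Longrightarrow> runs (Ite b p q) m (1 + bcost b + t) m'"
| IteFalse: "\<not> bval b m \<Longrightarrow> runs q m t m' \<Longrightarrow> runs (Ite b p q) m (1 + bcost b + t) m'"
| WhileFalse: "\<not> bval b m \<Longrightarrow> runs (While b p) m (1 + bcost b) m"
| WhileTrue: "bval b m \<Longrightarrow> runs p m t m' \<Longrightarrow> runs (While b p) m' t' m'' \<Longrightarrow>
    runs (While b p) m (1 + bcost b + t + t') m''"

inductive_cases SkipE: "runs Skip m t m'"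
inductive_cases NStoreE: "runs (NStore a b) m t m'"
inductive_cases RStoreE: "runs (RStore a b) m t m'"
inductive_cases SeqE: "runs (Seq p q) m t m'"
inductive_cases IteE: "runs (Ite b p q) m t m'"
inductive_cases WhileE: "runs (While b p) m t m'"

text \<open>Result and running time are determined by program and input.\<close>

lemma runs_deterministic:
  "runs p m t m' \<Longrightarrow> runs p m u m'' \<Longrightarrow> u = t \<and> m'' = m'"
proof (induction arbitrary: u m'' rule: runs.induct)
  case (Skip m)
  then show ?case by (auto elim: SkipE)
next
  case (NStore a b m)
  then show ?case by (auto elim: NStoreE)
next
  case (RStore a b m)
  then show ?case by (auto elim: RStoreE)
next
  case (Seq p m t m' q t' m2)
  from Seq.prems obtain t1 m1 t2 where "u = t1 + t2" "runs p m t1 m1" "runs q m1 t2 m''"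
    by (rule SeqE)
  with Seq.IH show ?case by metis
next
  case (IteTrue b m p t m' q)
  from IteTrue.prems IteTrue.hyps(1) obtain t1 where "u = 1 + bcost b + t1" "runs p m t1 m''"
    by (auto elim: IteE)
  with IteTrue.IH show ?case by metis
next
  case (IteFalse b m q t m' p)
  from IteFalse.prems IteFalse.hyps(1) obtain t1 where "u = 1 + bcost b + t1" "runs q m t1 m''"
    by (auto elim: IteE)
  with IteFalse.IH show ?case by metis
next
  case (WhileFalse b m p)
  then show ?case by (auto elim: WhileE)
next
  case (WhileTrue b m p t m' t' m2)
  from WhileTrue.prems WhileTrue.hyps(1) obtain t1 m1 t2
    where "u = 1 + bcost b + t1 + t2" "runs p m t1 m1" "runs (While b p) m1 t2 m''"
    by (auto elim: WhileE)
  with WhileTrue.IH show ?case by metis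
qed

text \<open>
  Input: \<open>n\<close>, \<open>k\<close> and the \<open>n \<times> n\<close> adjacency matrix in row-major order in the natural memory;
  the threshold and the \<open>n \<times> n\<close> weight matrix (with 0 for non-edges) in the real memory;
  all other cells are 0.
\<close>

definition wbd_input ::
    "nat \<Rightarrow> nat set set \<Rightarrow> nat \<Rightarrow> real \<Rightarrow> (nat set \<Rightarrow> real) \<Rightarrow> memory" where
  "wbd_input n E k wstar w =
    (\<lambda>a. if a = 0 then n
         else if a = 1 then k
         else if a - 2 < n * n \<and> {(a - 2) div n, (a - 2) mod n} \<in> E then 1
         else 0,
     \<lambda>a. if a = 0 then wstar
         else if a - 1 < n * n \<and> {(a - 1) div n, (a - 1) mod n} \<in> E
           then w {(a - 1) div n, (a - 1) mod n}
         else 0)"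

text \<open>A program answers by leaving 1 (yes) or 0 (no) in cell 0 of the natural memory.\<close>

definition answers_within :: "com \<Rightarrow> memory \<Rightarrow> bool \<Rightarrow> real \<Rightarrow> bool" where
  "answers_within p m ans T \<longleftrightarrow>
     (\<exists>t m'. runs p m t m' \<and> fst m' 0 = (if ans then 1 else 0) \<and> real t \<le> T)"

end

theory Submission
  imports Defs "HOL-Real_Asymp.Real_Asymp"
begin

text \<open>
  Let \<open>T = G - S\<close> be biconnected and call \<open>h \<in> E(T)\<close> bad if \<open>G - h\<close> is biconnected, but
  \<open>T + s - h\<close> is not, for any \<open>s \<in> S\<close>. The blocks of \<open>T - h\<close> form a path whose end blocks contain
  the two ends of \<open>h\<close>; some edge \<open>p1q1\<close> of \<open>S\<close> leaves one end block, some edge \<open>p2q2\<close> of \<open>S\<close>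
  leaves the other one, and no edge of \<open>S\<close> joins the two. By uncrossing, \<open>(p1, q1, p2, q2)\<close>
  determines \<open>h\<close>, so there are at most \<open>4|S|\<^sup>2\<close> bad edges.

  Hence, if none of the \<open>4k\<^sup>2 + 1\<close> heaviest deletable edges belongs to a solution \<open>S\<close>, one of them
  can replace an element of \<open>S\<close> without loss. It follows that branching on these edges, where an
  edge that is passed over is never considered again, finds a solution whenever there is one; the
  search tree has depth \<open>k\<close> and degree \<open>4k\<^sup>2 + 1\<close>.
\<close>

section \<open>Deletable edges and exchange\<close>

text \<open>The obstacle is that a heavy deletable edge \<open>h\<close> outside \<open>S\<close>
  cannot simply be traded for a lighter edge of \<open>S\<close>: every \<open>T + s - h\<close> may
  have a cut vertex although \<open>G - h\<close> has none. So the edges for which this happens have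
  to be counted. Blocks are not formalized. Biconnectivity becomes a cut condition,
  \<open>cut_linked\<close>, that forbids a vertex set to be attached to other vertices through a
  single vertex \<open>v\<close> only. An end block without its cut vertex is a minimal set attached
  to the rest by one vertex and \<open>h\<close>, and every case of the uncrossing exhibits a set
  that violates the cut condition. Ordered pairs are counted because a signature tells which end of
  an edge of \<open>S\<close> lies in the end block: \<open>2 * |S|\<close> choices, twice. The
  number of leaves, \<open>(4k^2 + 1)^k\<close>, is \<open>2^(O(k log k))\<close>. The machine has
  neither recursion nor division, so the leaves are enumerated by a number whose digits are the
  choices on the way. Extracting a digit by subtraction may cost as much as the number of leaves,
  which only doubles the exponent.\<close>

definition cut_linked :: "'a set \<Rightarrow> 'a set set \<Rightarrow> bool" where
  "cut_linked V T \<longleftrightarrow> (\<forall>P v. P \<subseteq> V \<and> P \<noteq> {} \<and> V - P - {v} \<noteq> {} \<longrightarrow>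
     (\<exists>a\<in>P. \<exists>b\<in>V - P - {v}. {a, b} \<in> T))"

lemma cut_linkedE:
  assumes "cut_linked V T" "P \<subseteq> V" "p \<in> P" "z \<in> V" "z \<notin> P" "z \<noteq> v"
  obtains a b where "a \<in> P" "b \<in> V" "b \<notin> P" "b \<noteq> v" "{a, b} \<in> T"
proof -
  have "V - P - {v} \<noteq> {}" "P \<noteq> {}" using assms by auto
  then show ?thesis using assms(1,2) that unfolding cut_linked_def by blast
qed

lemma rtrancl_adjacency_closed:
  assumes "(x, y) \<in> (adjacency F)\<^sup>*" "x \<in> P" "\<And>a b. a \<in> P \<Longrightarrow> {a, b} \<in> F \<Longrightarrow> b \<in> P"
  shows "y \<in> P"
  using assms(1,2) by (induction rule: rtrancl_induct) (auto simp: adjacency_def intro: assms(3))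

text \<open>A set whose outgoing edges all end in one vertex \<open>v\<close> of its complement
  makes \<open>v\<close> a cut vertex; if \<open>v\<close> lies in the set or outside
  \<open>V\<close>, no edge leaves the set and connectedness fails. Conversely, the vertices
  reachable from one vertex, in \<open>T\<close> or in \<open>T\<close> without \<open>v\<close>,
  form such a set.\<close>

lemma biconnected_iff_cut_linked:
  assumes sg: "simple_graph V T"
  shows "biconnected V T \<longleftrightarrow> 2 \<le> card V \<and> cut_linked V T"
proof
  assume bi: "biconnected V T"
  have con: "\<And>u v. u \<in> V \<Longrightarrow> v \<in> V \<Longrightarrow> (u, v) \<in> (adjacency T)\<^sup>*"
    using bi by (auto simp: biconnected_def connected_graph_def)
  have "\<exists>a\<in>P. \<exists>b\<in>V - P - {v}. {a, b} \<in> T" if P: "P \<subseteq> V" "p \<in> P" "z \<in> V - P - {v}" for P v p z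
  proof (rule ccontr)
    assume no: "\<not> ?thesis"
    have inV: "a \<in> V \<and> b \<in> V" if "{a, b} \<in> T" for a b
      using sg that unfolding simple_graph_def by blast
    have inP: "b \<in> P" if "a \<in> P" "{a, b} \<in> T" "b \<noteq> v" for a b
      using inV[of a b] no that by blast
    show False
    proof (cases "v \<in> V \<and> v \<notin> P")
      case True
      have "(p, z) \<notin> (adjacency (delete_vertex T v))\<^sup>*"
      proof
        assume "(p, z) \<in> (adjacency (delete_vertex T v))\<^sup>*"
        then have "z \<in> P"
          by (rule rtrancl_adjacency_closed) (use P inP in \<open>auto simp: delete_vertex_def\<close>)
        then show False using P by auto
      qed
      moreover have "(p, z) \<in> (adjacency T)\<^sup>*" using P con by auto
      ultimately have "cut_vertex V T v" using True P unfolding cut_vertex_def by blast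
      then show False using bi by (auto simp: biconnected_def)
    next
      case False
      have "(p, z) \<in> (adjacency T)\<^sup>*" using P con by auto
      then have "z \<in> P"
        by (rule rtrancl_adjacency_closed) (use P inP False inV in blast)+
      then show False using P by auto
    qed
  qed
  then show "2 \<le> card V \<and> cut_linked V T"
    using bi unfolding cut_linked_def biconnected_def by blast
next
  assume *: "2 \<le> card V \<and> cut_linked V T"
  then have cl: "cut_linked V T" by simp
  have "(u, z) \<in> (adjacency T)\<^sup>*" if uz: "u \<in> V" "z \<in> V" for u z
  proof (rule ccontr)
    assume no: "(u, z) \<notin> (adjacency T)\<^sup>*"
    let ?P = "{p \<in> V. (u, p) \<in> (adjacency T)\<^sup>*}"
    obtain a b where "a \<in> ?P" "b \<in> V" "b \<notin> ?P" "{a, b} \<in> T"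
      by (rule cut_linkedE[OF cl, of ?P u z u]) (use uz no in auto)
    then show False by (auto simp: adjacency_def intro: rtrancl_into_rtrancl)
  qed
  moreover have "\<not> cut_vertex V T v" for v
  proof
    assume "cut_vertex V T v"
    then obtain x y where xy: "x \<in> V - {v}" "y \<in> V - {v}"
      "(x, y) \<notin> (adjacency (delete_vertex T v))\<^sup>*"
      by (auto simp: cut_vertex_def)
    let ?P = "{p \<in> V - {v}. (x, p) \<in> (adjacency (delete_vertex T v))\<^sup>*}"
    obtain a b where ab: "a \<in> ?P" "b \<in> V" "b \<notin> ?P" "b \<noteq> v" "{a, b} \<in> T"
      by (rule cut_linkedE[OF cl, of ?P x y v]) (use xy in auto)
    then have "(a, b) \<in> adjacency (delete_vertex T v)"
      by (auto simp: adjacency_def delete_vertex_def)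
    then show False using ab by (auto intro: rtrancl_into_rtrancl)
  qed
  moreover have "V \<noteq> {}" using * by auto
  ultimately show "biconnected V T" using * by (auto simp: biconnected_def connected_graph_def)
qed

lemma cut_linked_mono: "cut_linked V T \<Longrightarrow> T \<subseteq> T' \<Longrightarrow> cut_linked V T'"
  unfolding cut_linked_def by blast

lemma simple_graph_subset: "simple_graph V E \<Longrightarrow> F \<subseteq> E \<Longrightarrow> simple_graph V F"
  by (auto simp: simple_graph_def)

lemma biconnected_mono:
  assumes "simple_graph V E" "F \<subseteq> E" "biconnected V F"
  shows "biconnected V E"
  using assms biconnected_iff_cut_linked simple_graph_subset cut_linked_mono by metis

section \<open>Sides of an edge and their minimal members\<close>

text \<open>
  For biconnected \<open>T\<close>, this says that \<open>c\<close> is a cut vertex of \<open>T - {x, y}\<close> and \<open>P\<close> is the side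
  of \<open>x\<close>. A minimal such \<open>P\<close> is the end block at \<open>x\<close> without \<open>c\<close>.
\<close>

definition edge_side :: "'a set \<Rightarrow> 'a set set \<Rightarrow> 'a set \<Rightarrow> 'a \<Rightarrow> 'a \<Rightarrow> 'a \<Rightarrow> bool" where
  "edge_side V T P x y c \<longleftrightarrow> P \<subseteq> V \<and> x \<in> P \<and> c \<in> V \<and> c \<notin> P \<and> y \<in> V \<and> y \<notin> P \<and> y \<noteq> c \<and>
     {x, y} \<in> T \<and> (\<forall>a\<in>P. \<forall>b\<in>V. {a, b} \<in> T \<longrightarrow> b \<in> P \<or> b = c \<or> a = x \<and> b = y)"

definition min_edge_side :: "'a set \<Rightarrow> 'a set set \<Rightarrow> 'a set \<Rightarrow> 'a \<Rightarrow> 'a \<Rightarrow> 'a \<Rightarrow> bool" where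
  "min_edge_side V T P x y c \<longleftrightarrow> edge_side V T P x y c \<and>
     (\<forall>Q d. edge_side V T Q x y d \<longrightarrow> card P \<le> card Q)"

lemma edge_sideD:
  assumes "edge_side V T P x y c"
  shows "P \<subseteq> V" "x \<in> P" "x \<in> V" "c \<in> V" "c \<notin> P" "y \<in> V" "y \<notin> P" "y \<noteq> c" "{x, y} \<in> T" "x \<noteq> c" "x \<noteq> y"
    "\<And>a b. a \<in> P \<Longrightarrow> b \<in> V \<Longrightarrow> {a, b} \<in> T \<Longrightarrow> b \<in> P \<or> b = c \<or> a = x \<and> b = y"
    "\<And>a b. a \<in> P \<Longrightarrow> b \<in> V \<Longrightarrow> {b, a} \<in> T \<Longrightarrow> b \<in> P \<or> b = c \<or> a = x \<and> b = y"
  using assms unfolding edge_side_def by (auto simp: insert_commute)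

lemma edge_side_compl:
  assumes "edge_side V T P x y c"
  shows "edge_side V T (V - P - {c}) y x c"
proof -
  note P = edge_sideD[OF assms]
  show ?thesis unfolding edge_side_def
  proof (intro conjI ballI impI)
    fix a b assume "a \<in> V - P - {c}" "b \<in> V" "{a, b} \<in> T"
    then show "b \<in> V - P - {c} \<or> b = c \<or> a = y \<and> b = x" using P(13)[of b a] by blast
  qed (use P in \<open>auto simp: insert_commute\<close>)
qed

lemma min_edge_side_exists:
  assumes "edge_side V T P x y c"
  obtains Q d where "min_edge_side V T Q x y d"
proof -
  let ?R = "\<lambda>m. \<exists>Q d. edge_side V T Q x y d \<and> card Q = m"
  have "?R (card P)" using assms by blast
  then have "?R (LEAST m. ?R m)" by (rule LeastI)
  then obtain Q d where Q: "edge_side V T Q x y d" "card Q = (LEAST m. ?R m)" by blast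
  have "card Q \<le> card Q'" if "edge_side V T Q' x y d'" for Q' d'
    unfolding Q(2) by (rule Least_le) (use that in blast)
  then show ?thesis using that Q(1) unfolding min_edge_side_def by blast
qed

text \<open>Uncrossing at one end: \<open>P \<inter> Q\<close> is again a side, with cut vertex
  \<open>c\<close> or \<open>e\<close>, so minimal cardinality gives
  \<open>P \<inter> Q = P\<close>. Hence a side of minimal size is the least one with respect to
  inclusion.\<close>

lemma min_edge_side_subset:
  assumes "cut_linked V T" "finite V" and m: "min_edge_side V T P x y c" and q: "edge_side V T Q x y e"
  shows "P \<subseteq> Q"
proof -
  have p: "edge_side V T P x y c" using m by (simp add: min_edge_side_def)
  note P = edge_sideD[OF p] and Q = edge_sideD[OF q]
  have "finite P" using P(1) assms(2) finite_subset by blast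
  have sub: "P \<subseteq> Q" if "edge_side V T (P \<inter> Q) x y d" for d
  proof -
    have "card P \<le> card (P \<inter> Q)" using m that by (auto simp: min_edge_side_def)
    then have "P \<inter> Q = P" using \<open>finite P\<close> by (intro card_seteq) auto
    then show ?thesis by blast
  qed
  show ?thesis
  proof (cases "c \<in> Q")
    case c: True
    show ?thesis
    proof (cases "e \<in> P")
      case True
      \<comment> \<open>With \<open>c \<in> Q\<close> and \<open>e \<in> P\<close> the intersection
        need not be a side. But then the vertices outside \<open>P \<union> Q\<close>, among them
        \<open>y\<close>, are attached to the rest at \<open>x\<close> alone.\<close>
      let ?R = "V - P - Q - {c, e}"
      obtain a b where "a \<in> ?R" "b \<in> V" "b \<notin> ?R" "b \<noteq> x" "{a, b} \<in> T"
        by (rule cut_linkedE[OF assms(1), of ?R y c x]) (use P(1-11) Q(1-11) c True in auto)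
      then show ?thesis using P(13)[of b a] Q(13)[of b a] P(2) Q(2) True c by blast
    next
      case False
      have "b \<in> P \<inter> Q \<or> b = c \<or> a = x \<and> b = y" if "a \<in> P \<inter> Q" "b \<in> V" "{a, b} \<in> T" for a b
        using that P(12)[of a b] Q(12)[of a b] False c by blast
      then have "edge_side V T (P \<inter> Q) x y c"
        using P(1-11) Q(1-11) c unfolding edge_side_def by blast
      then show ?thesis by (rule sub)
    qed
  next
    case False
    have "b \<in> P \<inter> Q \<or> b = e \<or> a = x \<and> b = y" if "a \<in> P \<inter> Q" "b \<in> V" "{a, b} \<in> T" for a b
      using that P(12)[of a b] Q(12)[of a b] False by blast
    then have "edge_side V T (P \<inter> Q) x y e"
      using P(1-11) Q(1-11) unfolding edge_side_def by blast
    then show ?thesis by (rule sub)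
  qed
qed


section \<open>Uncrossing the end blocks of two edges\<close>

text \<open>First exclusion for two edges with the same signature: the second edge cannot lie within
  an end block of the first. Each case ends with a set attached to the rest at one vertex; the
  vertices \<open>q1\<close>, \<open>q2\<close> and \<open>c\<close> witness that such a set, and
  what lies beyond it, is nonempty.\<close>

lemma edge_in_side_impossible:
  assumes cl: "cut_linked V T" and fin: "finite V"
    and mA: "min_edge_side V T A x y c" and eB: "edge_side V T B y x c'"
    and disj: "A \<inter> B = {}" "c \<noteq> c'" "c \<notin> B" "c' \<notin> A"
    and eD: "edge_side V T D yg xg d" and g: "xg \<in> A \<union> {c}" "yg \<in> A \<union> {c}"
    and p1: "p1 \<in> A" "p1 \<notin> D" and q2: "q2 \<in> B" "q2 \<in> D"
    and q1: "q1 \<in> V" "q1 \<notin> A" "q1 \<noteq> c" "q1 \<notin> B" "q1 \<notin> D"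
  shows False
proof -
  have eA: "edge_side V T A x y c" using mA by (simp add: min_edge_side_def)
  note A = edge_sideD[OF eA] and B = edge_sideD[OF eB] and D = edge_sideD[OF eD]
  have q2V: "q2 \<in> V" using q2 B by auto
  have p1V: "p1 \<in> V" using p1 A by auto
  show False
  proof (cases "d \<in> A \<union> {c}")
    case dA: True
    \<comment> \<open>\<open>D\<close> splits the region outside \<open>A \<union> {c}\<close>:
      \<open>q2\<close> is in \<open>D\<close>, \<open>q1\<close> is not, and no edge joins the two
      parts. If \<open>d = c\<close>, the part without \<open>y\<close> hangs on \<open>c\<close>
      alone; if \<open>d\<close> is in \<open>A\<close>, the part that is not adjacent to
      \<open>c\<close> hangs on \<open>x\<close> alone.\<close>
    show False
    proof (cases "d = c")
      case True
      show False
      proof (cases "y \<in> D")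
        case True
        obtain a b where "a \<in> V - A - {c} - D" "b \<in> V" "b \<notin> V - A - {c} - D" "b \<noteq> c" "{a, b} \<in> T"
          by (rule cut_linkedE[OF cl, of "V - A - {c} - D" q1 q2 c]) (use q1 q2 q2V disj in auto)
        then show False using A(13)[of b a] D(13)[of b a] True \<open>d = c\<close> g by blast
      next
        case False
        obtain a b where "a \<in> D - A - {c}" "b \<in> V" "b \<notin> D - A - {c}" "b \<noteq> c" "{a, b} \<in> T"
          by (rule cut_linkedE[OF cl, of "D - A - {c}" q2 q1 c]) (use q1 q2 q2V disj D(1-11) in auto)
        then show False using A(13)[of b a] D(1) D(12)[of a b] False \<open>d = c\<close> g by blast
      qed
    next
      case dc: False
      show False
      proof (cases "c \<in> D")
        case True
        obtain a b where "a \<in> V - A - {c} - D" "b \<in> V" "b \<notin> V - A - {c} - D" "b \<noteq> x" "{a, b} \<in> T"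
          by (rule cut_linkedE[OF cl, of "V - A - {c} - D" q1 q2 x]) (use q1 q2 q2V disj A(1-11) in auto)
        then show False using A(13)[of b a] D(13)[of b a] True dA dc g by blast
      next
        case False
        obtain a b where "a \<in> D - A - {c}" "b \<in> V" "b \<notin> D - A - {c}" "b \<noteq> x" "{a, b} \<in> T"
          by (rule cut_linkedE[OF cl, of "D - A - {c}" q2 q1 x]) (use q1 q2 q2V disj D(1-11) A(1-11) in auto)
        then show False using A(13)[of b a] D(1) D(12)[of a b] False dA dc g by blast
      qed
    qed
  next
    case dA: False
    \<comment> \<open>\<open>L\<close> is the side of the second edge that avoids \<open>c\<close>.
      Then \<open>L \<inter> A\<close> can be left only towards \<open>go\<close> or along
      \<open>{x, y}\<close>, so it is a side of \<open>{x, y}\<close> with cut vertex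
      \<open>go\<close>, and the minimality of \<open>A\<close> gives
      \<open>A \<subseteq> L\<close>.\<close>
    define L where "L = (if c \<in> D then V - D - {d} else D)"
    have "\<exists>gl go. edge_side V T L gl go d \<and> gl \<in> A \<union> {c} \<and> go \<in> A \<union> {c}"
      using eD edge_side_compl[OF eD] g by (cases "c \<in> D") (auto simp: L_def)
    then obtain gl go where eL: "edge_side V T L gl go d" and glo: "gl \<in> A \<union> {c}" "go \<in> A \<union> {c}"
      by blast
    note L = edge_sideD[OF eL]
    have cL: "c \<notin> L" by (auto simp: L_def)
    have gl: "gl \<in> A" using glo(1) cL L(2) by auto
    have leave: "b = go \<or> a = x \<and> b = y" if "a \<in> L \<inter> A" "b \<in> V" "b \<notin> L \<inter> A" "{a, b} \<in> T" for a b
      using that A(12)[of a b] L(12)[of a b] dA cL by blast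
    have xL: "x \<in> L"
    proof (rule ccontr)
      assume x: "x \<notin> L"
      obtain a b where "a \<in> L \<inter> A" "b \<in> V" "b \<notin> L \<inter> A" "b \<noteq> go" "{a, b} \<in> T"
        by (rule cut_linkedE[OF cl, of "L \<inter> A" gl d go]) (use gl L(1-11) A(1-11) dA glo in auto)
      then show False using leave[of a b] x by blast
    qed
    have "edge_side V T (L \<inter> A) x y go"
      unfolding edge_side_def
    proof (intro conjI ballI impI)
      show "y \<noteq> go" using glo B(2) disj by auto
      fix a b assume "a \<in> L \<inter> A" "b \<in> V" "{a, b} \<in> T"
      then show "b \<in> L \<inter> A \<or> b = go \<or> a = x \<and> b = y" using leave[of a b] by blast
    qed (use xL A(1-11) L(1-11) in auto)
    then have "card A \<le> card (L \<inter> A)" using mA unfolding min_edge_side_def by blast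
    then have "L \<inter> A = A" using fin A(1) by (intro card_seteq) (auto intro: finite_subset)
    then have AL: "A \<subseteq> L" by blast
    \<comment> \<open>Here \<open>p1\<close> decides that \<open>L\<close> is the complement of
      \<open>D\<close> and not \<open>D\<close> itself. It follows that the end \<open>yg\<close> of
      the second edge is \<open>c\<close>.\<close>
    have cD: "c \<in> D" using AL p1 by (auto simp: L_def split: if_splits)
    then have AD: "A \<inter> D = {}" using AL by (auto simp: L_def)
    have xgA: "xg \<in> A" using g(1) cD D(7) by auto
    have yD: "y \<notin> D" using A(9) A(2,3) D(12)[of y x] AD dA g disj B(2) by (auto simp: insert_commute)
    have dB: "d \<in> B"
    proof (rule ccontr)
      assume dB: "d \<notin> B"
      obtain a b where "a \<in> B \<inter> D" "b \<in> V" "b \<notin> B \<inter> D" "b \<noteq> c'" "{a, b} \<in> T"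
        by (rule cut_linkedE[OF cl, of "B \<inter> D" q2 y c']) (use q2 B(1-11) yD in auto)
      then show False using B(12)[of a b] D(12)[of a b] dB g disj yD by blast
    qed
    show False
    \<comment> \<open>If \<open>c'\<close> is in \<open>D\<close>, nothing links the vertices
      outside \<open>A\<close>, \<open>B\<close> and \<open>D\<close> to the rest; otherwise
      \<open>D - B\<close> hangs on \<open>xg\<close> alone.\<close>
    proof (cases "c' \<in> D")
      case True
      obtain a b where "a \<in> V - A - B - D" "b \<in> V" "b \<notin> V - A - B - D" "b \<noteq> x" "{a, b} \<in> T"
        by (rule cut_linkedE[OF cl, of "V - A - B - D" q1 c x]) (use q1 A(1-11) cD in auto)
      then show False
        using A(13)[of b a] B(13)[of b a] D(13)[of b a] True cD dB g A(2) B(2) by blast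
    next
      case False
      have "q1 \<noteq> xg" using q1 xgA by blast
      have sub: "D - B \<subseteq> V" "c \<in> D - B" "q1 \<in> V" "q1 \<notin> D - B" using D(1) cD disj q1 by blast+
      obtain a b where ab: "a \<in> D - B" "b \<in> V" "b \<notin> D - B" "b \<noteq> xg" "{a, b} \<in> T"
        using cut_linkedE[OF cl sub \<open>q1 \<noteq> xg\<close>] by blast
      have "a \<noteq> c'" "a \<noteq> x" using ab(1) False A(2) AD by blast+
      then have "b \<notin> B" using B(13)[of b a] ab D(1) by blast
      then show False using D(12)[of a b] ab dB by blast
    qed
  qed
qed

text \<open>Second exclusion: neither edge touches the sides of the other. Each cut vertex must lie
  in the corresponding side of the other edge, for otherwise \<open>A \<inter> C\<close> or
  \<open>B \<inter> D\<close> hangs on one vertex. Then the four sides contain all their exits, and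
  the vertices outside them, among them \<open>q1\<close>, are cut off.\<close>

lemma edges_in_middle_impossible:
  assumes cl: "cut_linked V T"
    and eA: "edge_side V T A x y c" and eB: "edge_side V T B y x c'"
    and disj: "A \<inter> B = {}" "c \<noteq> c'" "c \<notin> B" "c' \<notin> A"
    and eC: "edge_side V T C xg yg d" and eD: "edge_side V T D yg xg d'"
    and disjg: "C \<inter> D = {}" "d \<noteq> d'" "d \<notin> D" "d' \<notin> C"
    and out: "xg \<notin> A \<union> B" "yg \<notin> A \<union> B" "x \<notin> C \<union> D" "y \<notin> C \<union> D"
    and p1: "p1 \<in> A" "p1 \<in> C" and q2: "q2 \<in> B" "q2 \<in> D"
    and q1: "q1 \<in> V - A - B - C - D"
  shows False
proof -
  note A = edge_sideD[OF eA] and B = edge_sideD[OF eB] and C = edge_sideD[OF eC] and D = edge_sideD[OF eD]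
  have q2V: "q2 \<in> V" using q2 B by auto
  have p1V: "p1 \<in> V" using p1 A by auto
  have cC: "c \<in> C"
  proof (rule ccontr)
    assume n: "c \<notin> C"
    obtain a b where "a \<in> A \<inter> C" "b \<in> V" "b \<notin> A \<inter> C" "b \<noteq> d" "{a, b} \<in> T"
      by (rule cut_linkedE[OF cl, of "A \<inter> C" p1 q2 d]) (use p1 q2 q2V A(1-11) disj disjg in auto)
    then show False using A(12)[of a b] C(12)[of a b] n out by blast
  qed
  have cD: "c' \<in> D"
  proof (rule ccontr)
    assume n: "c' \<notin> D"
    obtain a b where "a \<in> B \<inter> D" "b \<in> V" "b \<notin> B \<inter> D" "b \<noteq> d'" "{a, b} \<in> T"
      by (rule cut_linkedE[OF cl, of "B \<inter> D" q2 p1 d']) (use p1 q2 p1V B(1-11) disj disjg in auto)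
    then show False using B(12)[of a b] D(12)[of a b] n out by blast
  qed
  have dA: "d \<in> A"
  proof (rule ccontr)
    assume n: "d \<notin> A"
    obtain a b where "a \<in> A \<inter> C" "b \<in> V" "b \<notin> A \<inter> C" "b \<noteq> c" "{a, b} \<in> T"
      by (rule cut_linkedE[OF cl, of "A \<inter> C" p1 q2 c]) (use p1 q2 q2V A(1-11) disj disjg in auto)
    then show False using A(12)[of a b] C(12)[of a b] n out by blast
  qed
  have dB: "d' \<in> B"
  proof (rule ccontr)
    assume n: "d' \<notin> B"
    obtain a b where "a \<in> B \<inter> D" "b \<in> V" "b \<notin> B \<inter> D" "b \<noteq> c'" "{a, b} \<in> T"
      by (rule cut_linkedE[OF cl, of "B \<inter> D" q2 p1 c']) (use p1 q2 p1V B(1-11) disj disjg in auto)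
    then show False using B(12)[of a b] D(12)[of a b] n out by blast
  qed
  obtain a b where "a \<in> V - A - B - C - D" "b \<in> V" "b \<notin> V - A - B - C - D" "b \<noteq> x" "{a, b} \<in> T"
    by (rule cut_linkedE[OF cl, of "V - A - B - C - D" q1 q2 x]) (use q1 q2 q2V A(1-11) disj in auto)
  then show False
    using A(13)[of b a] B(13)[of b a] C(13)[of b a] D(13)[of b a] cC cD dA dB A(2) B(2) C(2) D(2) by blast
qed

text \<open>Both pairs are directed from the \<open>x\<close> end to the \<open>y\<close> end, hence
  \<open>p1 \<in> A\<close> but \<open>q2 \<in> B\<close>. Reversing \<open>{x, y}\<close> exchanges
  \<open>p1\<close>, \<open>q1\<close> with \<open>q2\<close>, \<open>p2\<close>, which makes the
  two ends symmetric.\<close>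

definition critical_signature ::
    "'a set \<Rightarrow> 'a set set \<Rightarrow> 'a \<Rightarrow> 'a \<Rightarrow> 'a \<Rightarrow> 'a \<Rightarrow> 'a \<Rightarrow> 'a \<Rightarrow> bool" where
  "critical_signature V T x y p1 q1 p2 q2 \<longleftrightarrow>
    (\<exists>A c B c'. min_edge_side V T A x y c \<and> min_edge_side V T B y x c' \<and>
       A \<inter> B = {} \<and> c \<noteq> c' \<and> c \<notin> B \<and> c' \<notin> A \<and> p1 \<in> A \<and> q2 \<in> B \<and>
       q1 \<in> V - A - B - {c} \<and> p2 \<in> V - A - B - {c'})"

text \<open>An edge of \<open>T\<close> with an end in \<open>A\<close> stays within
  \<open>A \<union> {c}\<close> unless it is \<open>{x, y}\<close>. So of two different edges either
  one lies within an end block of the other, or neither has an end in the sides of the other. Both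
  situations are excluded above.\<close>

lemma critical_signature_unique:
  assumes cl: "cut_linked V T" and fin: "finite V"
    and f: "critical_signature V T x y p1 q1 p2 q2"
    and g: "critical_signature V T xg yg p1 q1 p2 q2"
  shows "{x, y} = {xg, yg}"
proof (rule ccontr)
  assume ne: "{x, y} \<noteq> {xg, yg}"
  from f obtain A c B c' where mA: "min_edge_side V T A x y c" and mB: "min_edge_side V T B y x c'"
    and dj: "A \<inter> B = {}" "c \<noteq> c'" "c \<notin> B" "c' \<notin> A" and p1: "p1 \<in> A" and q2: "q2 \<in> B"
    and q1: "q1 \<in> V - A - B - {c}" and p2: "p2 \<in> V - A - B - {c'}"
    unfolding critical_signature_def by blast
  from g obtain C d D d' where mC: "min_edge_side V T C xg yg d" and mD: "min_edge_side V T D yg xg d'"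
    and djg: "C \<inter> D = {}" "d \<noteq> d'" "d \<notin> D" "d' \<notin> C" and p1g: "p1 \<in> C" and q2g: "q2 \<in> D"
    and q1g: "q1 \<in> V - C - D - {d}" and p2g: "p2 \<in> V - C - D - {d'}"
    unfolding critical_signature_def by blast
  have eA: "edge_side V T A x y c" using mA by (simp add: min_edge_side_def)
  have eB: "edge_side V T B y x c'" using mB by (simp add: min_edge_side_def)
  have eC: "edge_side V T C xg yg d" using mC by (simp add: min_edge_side_def)
  have eD: "edge_side V T D yg xg d'" using mD by (simp add: min_edge_side_def)
  note A = edge_sideD[OF eA] and B = edge_sideD[OF eB] and C = edge_sideD[OF eC] and D = edge_sideD[OF eD]
  have 1: "\<not> (xg \<in> A \<union> {c} \<and> yg \<in> A \<union> {c})"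
    using edge_in_side_impossible[OF cl fin mA eB dj eD, of p1 q2 q1] p1 q2 q1 p1g q2g q1g djg by blast
  \<comment> \<open>The same exclusion seen from the other end: \<open>B\<close>, \<open>q2\<close>,
    \<open>p2\<close> take the parts of \<open>A\<close>, \<open>p1\<close>,
    \<open>q1\<close>.\<close>
  have 2: "\<not> (xg \<in> B \<union> {c'} \<and> yg \<in> B \<union> {c'})"
    using edge_in_side_impossible[OF cl fin mB eA _ _ _ _ eC, of q2 p1 p2] p1 q2 p2 p1g q2g p2g djg dj by blast
  have 3: "\<not> (x \<in> C \<union> {d} \<and> y \<in> C \<union> {d})"
    using edge_in_side_impossible[OF cl fin mC eD djg eB, of p1 q2 q1] p1 q2 q1 p1g q2g q1g dj by blast
  have 4: "\<not> (x \<in> D \<union> {d'} \<and> y \<in> D \<union> {d'})"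
    using edge_in_side_impossible[OF cl fin mD eC _ _ _ _ eA, of q2 p1 p2] p1 q2 p2 p1g q2g p2g djg dj by blast
  have "xg \<notin> A \<union> B" "yg \<notin> A \<union> B"
    using A(12)[of xg yg] A(13)[of yg xg] B(12)[of xg yg] B(13)[of yg xg] C(3,6,9) 1 2 ne
    by (auto simp: doubleton_eq_iff)
  moreover have "x \<notin> C \<union> D" "y \<notin> C \<union> D"
    using C(12)[of x y] C(13)[of y x] D(12)[of x y] D(13)[of y x] A(3,6,9) 3 4 ne
    by (auto simp: doubleton_eq_iff)
  ultimately show False
    using edges_in_middle_impossible[OF cl eA eB dj eC eD djg, of p1 q2 q1] p1 q2 q1 p1g q2g q1g by blast
qed

section \<open>Signatures of bad edges and the exchange\<close>

text \<open>A set that violates \<open>cut_linked\<close> after the deletion is left only along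
  \<open>{x, y}\<close> and towards some \<open>v\<close>. If \<open>v\<close> were no vertex of its
  complement, \<open>{x, y}\<close> would be a bridge and, because of the third vertex
  \<open>z\<close>, one of its ends a cut vertex of \<open>T\<close>. With only two vertices,
  deleting the edge leaves no side.\<close>

lemma not_cut_linked_edge_side:
  assumes cl: "cut_linked V T" and fin: "simple_graph V T" and h: "{x, y} \<in> T"
    and z: "z \<in> V" "z \<noteq> x" "z \<noteq> y" and n: "\<not> cut_linked V (T - {{x, y}})"
  obtains P c where "edge_side V T P x y c"
proof -
  from n obtain P v where P: "P \<subseteq> V" "P \<noteq> {}" "V - P - {v} \<noteq> {}"
    and no0: "\<not> (\<exists>a\<in>P. \<exists>b\<in>V - P - {v}. {a, b} \<in> T - {{x, y}})"
    unfolding cut_linked_def by metis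
  have no: "{a, b} = {x, y}" if "a \<in> P" "b \<in> V - P - {v}" "{a, b} \<in> T" for a b
    using no0 that by auto
  obtain a b where ab: "a \<in> P" "b \<in> V - P - {v}" "{a, b} \<in> T"
    using cl P unfolding cut_linked_def by blast
  have abxy: "{a, b} = {x, y}" using no ab by blast
  have "\<not> (v \<in> P \<or> v \<notin> V)"
  proof
    assume v: "v \<in> P \<or> v \<notin> V"
    have no': "{a', b'} = {a, b}" if "a' \<in> P" "b' \<in> V - P" "{a', b'} \<in> T" for a' b'
      using no[of a' b'] that v abxy by blast
    have zab: "z \<noteq> a" "z \<noteq> b" using abxy z by (auto simp: doubleton_eq_iff)
    show False
    proof (cases "z \<in> P")
      case True
      then have "P - {a} \<subseteq> V" "z \<in> P - {a}" "b \<in> V" "b \<notin> P - {a}" "b \<noteq> a" using P ab zab by auto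
      from cut_linkedE[OF cl this] obtain a' b' where *: "a' \<in> P - {a}" "b' \<in> V" "b' \<notin> P - {a}" "b' \<noteq> a" "{a', b'} \<in> T"
        by blast
      then have "{a', b'} = {a, b}" using no' by blast
      then show False using * ab by (auto simp: doubleton_eq_iff)
    next
      case False
      have s: "V - P - {b} \<subseteq> V" "z \<in> V - P - {b}" "a \<in> V" "a \<notin> V - P - {b}" "a \<noteq> b" using P ab zab z False by auto
      from cut_linkedE[OF cl this] obtain a' b' where *: "a' \<in> V - P - {b}" "b' \<in> V" "b' \<notin> V - P - {b}" "b' \<noteq> b" "{a', b'} \<in> T"
        by blast
      then have "{b', a'} = {a, b}" using no'[of b' a'] by (auto simp: insert_commute)
      then show False using * ab by (auto simp: doubleton_eq_iff)
    qed
  qed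
  then have v: "v \<notin> P" "v \<in> V" by auto
  have e: "edge_side V T P a b v"
    unfolding edge_side_def
  proof (intro conjI ballI impI)
    fix a' b' assume *: "a' \<in> P" "b' \<in> V" "{a', b'} \<in> T"
    show "b' \<in> P \<or> b' = v \<or> a' = a \<and> b' = b"
    proof (rule ccontr)
      assume "\<not> ?thesis"
      moreover from this have "{a', b'} = {a, b}" using no[of a' b'] * abxy by blast
      ultimately show False using * ab by (auto simp: doubleton_eq_iff)
    qed
  qed (use P ab v in auto)
  consider "a = x" "b = y" | "a = y" "b = x" using abxy by (auto simp: doubleton_eq_iff)
  then show ?thesis
  proof cases
    case 1 then show ?thesis using that e by blast
  next
    case 2 then show ?thesis using that edge_side_compl[OF e] by blast
  qed
qed

lemma edge_side_subgraph:
  assumes "edge_side V T' P x y c" "T \<subseteq> T'" "{x, y} \<in> T"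
  shows "edge_side V T P x y c"
  using assms unfolding edge_side_def by blast

text \<open>A side of \<open>h\<close> in some \<open>T + s\<close> is one in \<open>T\<close> too,
  so the end blocks \<open>A\<close> and \<open>B\<close> exist. As
  \<open>T \<union> S - {h}\<close> is biconnected, an edge leaves each of them to a vertex other
  than its cut vertex, and such an edge can only come from \<open>S\<close>.\<close>

lemma critical_signature_exists:
  assumes sg: "simple_graph V (T \<union> S)" and cl: "cut_linked V T" and h: "h \<in> T"
    and del: "cut_linked V (T \<union> S - {h})"
    and bad: "\<And>s. s \<in> S \<Longrightarrow> \<not> cut_linked V (insert s T - {h})"
    and S: "S \<noteq> {}" "S \<inter> T = {}"
  obtains x y p1 q1 p2 q2 where "h = {x, y}" "{p1, q1} \<in> S" "{p2, q2} \<in> S"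
    "critical_signature V T x y p1 q1 p2 q2"
proof -
  have fin: "finite V" and sgT: "simple_graph V T"
    using sg by (auto simp: simple_graph_def)
  have "card h = 2" "h \<subseteq> V" using sgT h unfolding simple_graph_def by blast+
  then obtain x y where hxy: "h = {x, y}" "x \<noteq> y" by (auto simp: card_2_iff)
  have xy: "x \<in> V" "y \<in> V" using \<open>h \<subseteq> V\<close> hxy by auto
  have sub: "{x} \<subseteq> V" "x \<in> {x}" "y \<in> V" "y \<notin> {x}" "y \<noteq> x" using xy hxy by auto
  \<comment> \<open>A neighbour of \<open>x\<close> other than \<open>y\<close> serves as the third
    vertex.\<close>
  obtain z where z: "z \<in> V" "z \<noteq> x" "{x, z} \<in> T \<union> S - {h}"
    using cut_linkedE[OF del sub] by blast
  then have zy: "z \<noteq> y" using hxy by auto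
  have T: "{x, y} \<in> T" using h hxy by simp
  have side: "\<exists>Q e. edge_side V (insert s T) Q x y e" if "s \<in> S" for s
  proof -
    have "insert s T \<subseteq> T \<union> S" using that by auto
    then have "simple_graph V (insert s T)" using sg simple_graph_subset by blast
    moreover have "cut_linked V (insert s T)" using cl cut_linked_mono by blast
    ultimately show ?thesis
      using not_cut_linked_edge_side[of V "insert s T" x y z] T z(1,2) zy bad[OF that] hxy(1) by blast
  qed
  have side': "\<exists>Q e. edge_side V (insert s T) Q x y e \<and> edge_side V T Q x y e" if "s \<in> S" for s
    using side[OF that] edge_side_subgraph[of V "insert s T" _ x y _ T] T by blast
  obtain s0 where "s0 \<in> S" using S by blast
  from side'[OF this] obtain Q0 e0 where Q0: "edge_side V T Q0 x y e0" by blast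
  obtain A c where mA: "min_edge_side V T A x y c"
    by (rule min_edge_side_exists[OF Q0])
  obtain B c' where mB: "min_edge_side V T B y x c'"
    by (rule min_edge_side_exists[OF edge_side_compl[OF Q0]])
  have eA: "edge_side V T A x y c" using mA by (simp add: min_edge_side_def)
  have eB: "edge_side V T B y x c'" using mB by (simp add: min_edge_side_def)
  note A = edge_sideD[OF eA] and B = edge_sideD[OF eB]
  have BA: "B \<subseteq> V - A - {c}"
    by (rule min_edge_side_subset[OF cl fin mB edge_side_compl[OF eA]])
  have AB: "A \<subseteq> V - B - {c'}"
    by (rule min_edge_side_subset[OF cl fin mA edge_side_compl[OF eB]])
  obtain p1 q1 where pq1: "p1 \<in> A" "q1 \<in> V" "q1 \<notin> A" "q1 \<noteq> c" "{p1, q1} \<in> T \<union> S - {h}"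
    using cut_linkedE[OF del A(1,2,6,7,8)] by blast
  then have S1: "{p1, q1} \<in> S" using A(12)[of p1 q1] hxy(1) by blast
  obtain q2 p2 where pq2: "q2 \<in> B" "p2 \<in> V" "p2 \<notin> B" "p2 \<noteq> c'" "{q2, p2} \<in> T \<union> S - {h}"
    using cut_linkedE[OF del B(1,2,6,7,8)] by blast
  then have S2: "{q2, p2} \<in> S" using B(12)[of q2 p2] hxy(1) by blast
  \<comment> \<open>A side of \<open>h\<close> in \<open>T + {p, q}\<close> is also one in
    \<open>T\<close>, so it contains \<open>A\<close>, and its complement without the cut vertex
    contains \<open>B\<close>. The edge \<open>{p, q}\<close> would leave that side.\<close>
  have cross: False if "{p, q} \<in> S" "p \<in> A" "q \<in> B" for p q
  proof -
    obtain Q e where Q: "edge_side V (insert {p, q} T) Q x y e" "edge_side V T Q x y e"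
      using side'[OF \<open>{p, q} \<in> S\<close>] by blast
    have "A \<subseteq> Q" by (rule min_edge_side_subset[OF cl fin mA Q(2)])
    moreover have "B \<subseteq> V - Q - {e}"
      by (rule min_edge_side_subset[OF cl fin mB edge_side_compl[OF Q(2)]])
    ultimately have "p = x \<and> q = y"
      using edge_sideD(12)[OF Q(1), of p q] that by blast
    then show False using that T S(2) by blast
  qed
  have q1B: "q1 \<notin> B" using cross[OF S1] pq1 by blast
  have p2A: "p2 \<notin> A" using cross[of p2 q2] S2 pq2 by (auto simp: insert_commute)
  \<comment> \<open>With a common cut vertex, the vertices outside \<open>A\<close> and
    \<open>B\<close>, such as \<open>q1\<close>, would hang on it alone.\<close>
  have "c \<noteq> c'"
  proof
    assume cc: "c = c'"
    have "p1 \<in> V" "p1 \<notin> V - A - B - {c}" "p1 \<noteq> c" using pq1(1) A(1,5) by auto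
    moreover have "q1 \<in> V - A - B - {c}" using pq1 q1B by blast
    ultimately obtain a b where "a \<in> V - A - B - {c}" "b \<in> V" "b \<notin> V - A - B - {c}" "b \<noteq> c" "{a, b} \<in> T"
      using cut_linkedE[OF cl, of "V - A - B - {c}" q1 p1 c] by blast
    then show False using A(13)[of b a] B(13)[of b a] cc A(2) B(2) by blast
  qed
  then have "critical_signature V T x y p1 q1 p2 q2"
    unfolding critical_signature_def using mA mB AB BA pq1 pq2 q1B p2A by blast
  then show ?thesis using that hxy(1) S1 S2 by (simp add: insert_commute)
qed

lemma card_ordered_edges:
  assumes "finite S" "\<And>s. s \<in> S \<Longrightarrow> card s = 2"
  shows "finite {(a, b). {a, b} \<in> S}" "card {(a, b). {a, b} \<in> S} \<le> 2 * card S"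
proof -
  let ?R = "\<lambda>s. {(a, b). {a, b} = s}"
  have R: "finite (?R s) \<and> card (?R s) \<le> 2" if s: "card s = 2" for s :: "'a set"
  proof -
    obtain u v where "s = {u, v}" using s unfolding card_2_iff by blast
    then have sub: "?R s \<subseteq> set [(u, v), (v, u)]" by (auto simp: doubleton_eq_iff)
    have "card (?R s) \<le> card (set [(u, v), (v, u)])" by (rule card_mono[OF _ sub]) simp
    also have "\<dots> \<le> 2" using card_length[of "[(u, v), (v, u)]"] by simp
    finally show ?thesis using finite_subset[OF sub] by blast
  qed
  have eq: "{(a, b). {a, b} \<in> S} = (\<Union>s\<in>S. ?R s)" by auto
  show "finite {(a, b). {a, b} \<in> S}" unfolding eq using assms R by auto
  have "card {(a, b). {a, b} \<in> S} \<le> (\<Sum>s\<in>S. card (?R s))"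
    unfolding eq by (rule card_UN_le[OF assms(1)])
  also have "\<dots> \<le> (\<Sum>s\<in>S. 2)" by (rule sum_mono) (use R assms in auto)
  finally show "card {(a, b). {a, b} \<in> S} \<le> 2 * card S" by simp
qed

text \<open>Pigeonhole: without an exchange every \<open>h\<close> in \<open>H\<close> has a
  signature, and uniqueness makes the choice of one injective. Each edge of \<open>S\<close> gives
  two ordered pairs and a signature consists of two pairs, whence the bound
  \<open>(2 * card S) * (2 * card S)\<close>.\<close>

lemma biconnected_exchange:
  assumes sg: "simple_graph V (T \<union> S)" and bi: "biconnected V T"
    and H: "H \<subseteq> T" "\<And>h. h \<in> H \<Longrightarrow> biconnected V (T \<union> S - {h})" "card H > 4 * (card S)\<^sup>2"
    and S: "S \<noteq> {}" "S \<inter> T = {}" "finite S"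
  obtains h s where "h \<in> H" "s \<in> S" "biconnected V (insert s T - {h})"
proof (rule ccontr)
  assume "\<not> thesis"
  then have no: "\<not> biconnected V (insert s T - {h})" if "h \<in> H" "s \<in> S" for h s
    using that \<open>\<And>h s. \<lbrakk>h \<in> H; s \<in> S; biconnected V (insert s T - {h})\<rbrakk> \<Longrightarrow> thesis\<close> by blast
  have fin: "finite V" and sgT: "simple_graph V T" using sg by (auto simp: simple_graph_def)
  have cl: "cut_linked V T" "2 \<le> card V" using bi biconnected_iff_cut_linked[OF sgT] by auto
  have bic: "biconnected V F \<longleftrightarrow> cut_linked V F" if "F \<subseteq> T \<union> S" for F
    using biconnected_iff_cut_linked[OF simple_graph_subset[OF sg that]] cl by simp
  let ?O = "{(a, b). {a, b} \<in> S}"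
  have cS: "\<And>s. s \<in> S \<Longrightarrow> card s = 2" using sg by (auto simp: simple_graph_def)
  define W where "W h r \<longleftrightarrow> (\<exists>x y. h = {x, y} \<and>
    critical_signature V T x y (fst (fst r)) (snd (fst r)) (fst (snd r)) (snd (snd r)))" for h r
  have ex: "\<exists>r. r \<in> ?O \<times> ?O \<and> W h r" if "h \<in> H" for h
  proof -
    have hT: "h \<in> T" using H(1) that by blast
    have "T \<union> S - {h} \<subseteq> T \<union> S" by blast
    from bic[OF this] have del: "cut_linked V (T \<union> S - {h})" using H(2)[OF that] by simp
    have bad: "\<not> cut_linked V (insert s T - {h})" if "s \<in> S" for s
    proof -
      have "insert s T - {h} \<subseteq> T \<union> S" using that by blast
      from bic[OF this] show ?thesis using no[OF \<open>h \<in> H\<close> that] by simp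
    qed
    obtain x y p1 q1 p2 q2 where "h = {x, y}" "{p1, q1} \<in> S" "{p2, q2} \<in> S"
      "critical_signature V T x y p1 q1 p2 q2"
      by (rule critical_signature_exists[OF sg cl(1) hT del bad S(1,2)])
    then have "((p1, q1), (p2, q2)) \<in> ?O \<times> ?O" "W h ((p1, q1), (p2, q2))"
      unfolding W_def by auto
    then show ?thesis by blast
  qed
  then have "\<forall>h\<in>H. \<exists>r. r \<in> ?O \<times> ?O \<and> W h r" by blast
  then obtain r where r: "\<And>h. h \<in> H \<Longrightarrow> r h \<in> ?O \<times> ?O \<and> W h (r h)"
    unfolding bchoice_iff by blast
  have inj: "inj_on r H"
  proof (rule inj_onI)
    fix h h' assume *: "h \<in> H" "h' \<in> H" "r h = r h'"
    then have "W h (r h)" "W h' (r h)" using r[OF *(1)] r[OF *(2)] by auto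
    then show "h = h'" using critical_signature_unique[OF cl(1) fin] unfolding W_def by metis
  qed
  have "card H \<le> card (?O \<times> ?O)"
    proof (rule card_inj_on_le[OF inj])
    show "r ` H \<subseteq> ?O \<times> ?O" using r by blast
    show "finite (?O \<times> ?O)" using card_ordered_edges(1)[OF S(3) cS] by blast
  qed
  also have "\<dots> = card ?O * card ?O" by (rule card_cartesian_product)
  also have "\<dots> \<le> (2 * card S) * (2 * card S)"
    using card_ordered_edges(2)[OF S(3) cS] by (intro mult_mono) auto
  also have "\<dots> = 4 * (card S)\<^sup>2" by (simp add: power2_eq_square)
  finally show False using H(3) by simp
qed

section \<open>Bounded search\<close>

text \<open>
  Cell \<open>i\<close> of the adjacency matrix stands for the pair \<open>(i div n, i mod n)\<close>; only cells above the
  diagonal count. Their states are 0 (no edge), 1 (available), 2 (passed over) and 3 (deleted).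
  The digits of \<open>t\<close> in base \<open>N\<close> tell \<open>search\<close> how many edges to pass over before each
  deletion. The value \<open>n * n\<close> of \<open>best\<close> means that no edge is deletable.
\<close>

locale cell_search =
  fixes n :: nat and wt :: "nat \<Rightarrow> real" and N :: nat
begin

definition upper :: "nat \<Rightarrow> bool" where
  "upper i \<longleftrightarrow> i < n * n \<and> i div n < i mod n"

definition edge :: "nat \<Rightarrow> nat set" where
  "edge i = {i div n, i mod n}"

definition present :: "(nat \<Rightarrow> nat) \<Rightarrow> nat set" where
  "present g = {i. upper i \<and> (g i = 1 \<or> g i = 2)}"

definition deletable :: "(nat \<Rightarrow> nat) \<Rightarrow> nat \<Rightarrow> bool" where
  "deletable g i \<longleftrightarrow> upper i \<and> g i = 1 \<and> biconnected {..<n} (edge ` (present g - {i}))"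

primrec best :: "(nat \<Rightarrow> nat) \<Rightarrow> nat \<Rightarrow> nat" where
  "best g 0 = n * n"
| "best g (Suc j) = (if deletable g j \<and> (\<not> best g j < n * n \<or> wt (best g j) < wt j) then j else best g j)"

text \<open>Without a deletable cell nothing changes, so every number \<open>t\<close> describes a
  complete run of \<open>search\<close>, possibly with fewer deletions.\<close>

definition step :: "nat \<Rightarrow> (nat \<Rightarrow> nat) \<Rightarrow> nat \<Rightarrow> nat" where
  "step s g = (if best g (n * n) < n * n then g(best g (n * n) := s) else g)"

primrec search :: "nat \<Rightarrow> nat \<Rightarrow> (nat \<Rightarrow> nat) \<Rightarrow> nat \<Rightarrow> nat" where
  "search 0 t g = g"
| "search (Suc l) t g = search l (t div N) (step 3 ((step 2 ^^ (t mod N)) g))"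

definition deleted :: "(nat \<Rightarrow> nat) \<Rightarrow> nat set" where
  "deleted g = {i. upper i \<and> g i = 3}"

text \<open>Cells that were passed over stay present but cannot enter \<open>C\<close>. This is the
  restriction that the exchange argument has to justify.\<close>

definition feasible :: "real \<Rightarrow> nat \<Rightarrow> (nat \<Rightarrow> nat) \<Rightarrow> bool" where
  "feasible ws l g \<longleftrightarrow> (\<exists>C. C \<subseteq> {i. upper i \<and> g i = 1} \<and> card C \<le> l \<and>
     biconnected {..<n} (edge ` (present g - C)) \<and> ws \<le> sum wt (deleted g) + sum wt C)"

lemma finite_upper: "finite {i. upper i \<and> P i}"
  by (rule finite_subset[of _ "{..<n * n}"]) (auto simp: upper_def)

lemma finite_upper_subset: "C \<subseteq> {i. upper i \<and> P i} \<Longrightarrow> finite C"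
  using finite_upper finite_subset by blast

lemma inj_on_edge: "inj_on edge {i. upper i}"
proof (rule inj_onI)
  fix i j assume "i \<in> {i. upper i}" "j \<in> {i. upper i}" "edge i = edge j"
  then have "i div n = j div n" "i mod n = j mod n"
    by (auto simp: upper_def edge_def doubleton_eq_iff)
  then show "i = j" by (metis div_mult_mod_eq)
qed

lemma upper_bounds: "upper i \<Longrightarrow> i div n < n \<and> i mod n < n \<and> 0 < n"
  unfolding upper_def by (metis less_nat_zero_code less_trans mod_less_divisor mult_0 neq0_conv)

lemma simple_graph_edges: "C \<subseteq> {i. upper i} \<Longrightarrow> simple_graph {..<n} (edge ` C)"
  unfolding simple_graph_def edge_def
  using upper_bounds by (fastforce simp: upper_def)

lemma present_upper: "present g \<subseteq> {i. upper i}" by (auto simp: present_def)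

lemma biconnected_cells_mono:
  assumes "C \<subseteq> D" "D \<subseteq> {i. upper i}" "biconnected {..<n} (edge ` C)"
  shows "biconnected {..<n} (edge ` D)"
  using biconnected_mono[OF simple_graph_edges[OF assms(2)] image_mono[OF assms(1)] assms(3)] .

lemma best_spec:
  "j \<le> n * n \<Longrightarrow> (best g j = n * n \<and> (\<forall>i<j. \<not> deletable g i)) \<or>
     (best g j < j \<and> deletable g (best g j) \<and> (\<forall>i<j. deletable g i \<longrightarrow> wt i \<le> wt (best g j)))"
proof (induction j)
  case (Suc j)
  then consider "best g j = n * n" "\<forall>i<j. \<not> deletable g i"
    | "best g j < j" "deletable g (best g j)" "\<forall>i<j. deletable g i \<longrightarrow> wt i \<le> wt (best g j)"
    by fastforce
  then show ?case
  proof cases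
    case 1
    then show ?thesis using Suc.prems by (auto simp: less_Suc_eq)
  next
    case 2
    then have "best g j < n * n" using Suc.prems by simp
    then show ?thesis using 2 Suc.prems by (auto simp: less_Suc_eq)
  qed
qed simp

lemma best_deletable:
  assumes "best g (n * n) < n * n"
  shows "deletable g (best g (n * n))" "\<And>i. deletable g i \<Longrightarrow> wt i \<le> wt (best g (n * n))"
  using best_spec[of "n * n" g] assms by (auto simp: deletable_def upper_def)

lemma no_best: "\<not> best g (n * n) < n * n \<Longrightarrow> \<not> deletable g i"
  using best_spec[of "n * n" g] by (auto simp: deletable_def upper_def)

lemma step_spec:
  obtains "step s g = g" "\<And>i. \<not> deletable g i"
  | b where "step s g = g(b := s)" "b = best g (n * n)" "b < n * n" "deletable g b"
      "\<And>i. deletable g i \<Longrightarrow> wt i \<le> wt b"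
  using best_deletable[of g] no_best[of g] unfolding step_def by metis

section \<open>Soundness of every branch\<close>

text \<open>An invariant for every \<open>t\<close>: by the choice of \<open>deletable\<close>, each
  deletion keeps the graph biconnected, so no branch can accept wrongly. The last clause recovers
  the original edges from the states.\<close>

definition sound :: "nat \<Rightarrow> (nat \<Rightarrow> nat) \<Rightarrow> (nat \<Rightarrow> nat) \<Rightarrow> bool" where
  "sound l h g \<longleftrightarrow> card (deleted g) \<le> l \<and> biconnected {..<n} (edge ` present g) \<and>
     (\<forall>i. upper i \<longrightarrow> (g i \<in> {1, 2, 3} \<longleftrightarrow> h i = 1))"

lemma present_mark:
  assumes "g b = 1"
  shows "present (g(b := 2)) = present g" "deleted (g(b := 2)) = deleted g"
  using assms by (auto simp: present_def deleted_def)

lemma present_delete: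
  assumes "g b = 1" "upper b"
  shows "present (g(b := 3)) = present g - {b}" "deleted (g(b := 3)) = insert b (deleted g)" "b \<notin> deleted g"
  using assms by (auto simp: present_def deleted_def)

lemma finite_deleted: "finite (deleted g)"
  unfolding deleted_def by (rule finite_upper)

lemma sound_mark: "sound l h g \<Longrightarrow> sound l h (step 2 g)"
  by (rule step_spec[of 2 g]) (auto simp: sound_def present_mark deletable_def)

lemma sound_delete: "sound l h g \<Longrightarrow> sound (Suc l) h (step 3 g)"
  by (rule step_spec[of 3 g]) (auto simp: sound_def present_delete finite_deleted deletable_def)

lemma sound_marks: "sound l h g \<Longrightarrow> sound l h ((step 2 ^^ a) g)"
  by (induction a) (auto intro: sound_mark)

lemma sound_search: "sound m h g \<Longrightarrow> sound (m + l) h (search l t g)"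
proof (induction l arbitrary: m t g)
  case (Suc l)
  show ?case using Suc.IH[OF sound_delete[OF sound_marks[OF Suc.prems]]] by simp
qed simp

section \<open>Completeness: some branch finds a solution\<close>

text \<open>Passing over a cell leaves the graph as it is and cannot make another cell deletable. So
  the cells \<open>b j\<close> are distinct and already deletable in \<open>g\<close>, which the
  exchange requires.\<close>

lemma marks_eq:
  assumes "\<And>j. j < a \<Longrightarrow> best ((step 2 ^^ j) g) (n * n) < n * n"
  defines "b \<equiv> \<lambda>j. best ((step 2 ^^ j) g) (n * n)"
  shows "(step 2 ^^ a) g = (\<lambda>i. if i \<in> b ` {..<a} then 2 else g i) \<and> inj_on b {..<a} \<and>
    (\<forall>j<a. deletable g (b j)) \<and> present ((step 2 ^^ a) g) = present g \<and> deleted ((step 2 ^^ a) g) = deleted g"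
  using assms(1)
proof (induction a)
  case (Suc a)
  let ?g = "(step 2 ^^ a) g"
  have IH: "?g = (\<lambda>i. if i \<in> b ` {..<a} then 2 else g i)" "inj_on b {..<a}"
    "\<forall>j<a. deletable g (b j)" "present ?g = present g" "deleted ?g = deleted g"
    using Suc.IH Suc.prems by auto
  have "b a < n * n" using Suc.prems by (auto simp: b_def)
  then have del: "deletable ?g (b a)" and st: "step 2 ?g = ?g(b a := 2)"
    using best_deletable[of ?g] by (auto simp: b_def step_def)
  have g1: "?g (b a) = 1" using del by (simp add: deletable_def)
  have new: "b a \<notin> b ` {..<a}"
  proof
    assume "b a \<in> b ` {..<a}"
    then have "?g (b a) = 2" by (simp add: IH(1))
    then show False using g1 by simp
  qed
  then have "g (b a) = 1" using g1 by (simp add: IH(1))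
  then have "deletable g (b a)" using del by (simp add: deletable_def IH(4))
  moreover have "(step 2 ^^ Suc a) g = ?g(b a := 2)" using st by simp
  moreover have "?g(b a := 2) = (\<lambda>i. if i \<in> b ` {..<Suc a} then 2 else g i)"
    by (subst IH(1)) (auto simp: lessThan_Suc)
  moreover have "inj_on b {..<Suc a}" using IH(2) new by (simp add: lessThan_Suc)
  moreover have "present (?g(b a := 2)) = present g" "deleted (?g(b a := 2)) = deleted g"
    using present_mark[of ?g "b a"] g1 IH(4,5) by auto
  moreover have "\<forall>j<Suc a. deletable g (b j)" using IH(3) \<open>deletable g (b a)\<close> by (simp add: less_Suc_eq)
  ultimately show ?case by metis
qed simp

text \<open>The branch to follow passes over cells until one in \<open>C\<close> comes up, which is
  deleted. If the first \<open>N\<close> cells all avoid \<open>C\<close>, they are too many to be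
  bad, so one of them can replace some \<open>c\<close> in \<open>C\<close>; it is at least as
  heavy, because \<open>c\<close> was available when it was chosen.\<close>

lemma feasible_step:
  assumes f: "feasible ws (Suc l) g" and N: "4 * (Suc l)\<^sup>2 < N"
    and wt: "\<And>i. upper i \<Longrightarrow> g i = 1 \<Longrightarrow> 0 \<le> wt i"
  shows "\<exists>a<N. feasible ws l (step 3 ((step 2 ^^ a) g))"
proof -
  define b where "b j = best ((step 2 ^^ j) g) (n * n)" for j
  from f obtain C where C: "C \<subseteq> {i. upper i \<and> g i = 1}" "card C \<le> Suc l"
    "biconnected {..<n} (edge ` (present g - C))" "ws \<le> sum wt (deleted g) + sum wt C"
    unfolding feasible_def by blast
  have finC: "finite C" using C(1) finite_upper_subset by blast
  have Cdel: "deletable g c" if "c \<in> C" for c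
  proof -
    have "biconnected {..<n} (edge ` (present g - {c}))"
      by (rule biconnected_cells_mono[OF _ _ C(3)]) (use that present_upper in auto)
    then show ?thesis using that C(1) by (auto simp: deletable_def)
  qed
  have marks: "(step 2 ^^ a) g = (\<lambda>i. if i \<in> b ` {..<a} then 2 else g i)" "inj_on b {..<a}"
    "\<And>j. j < a \<Longrightarrow> deletable g (b j)" "present ((step 2 ^^ a) g) = present g"
    "deleted ((step 2 ^^ a) g) = deleted g"
    if "\<And>j. j < a \<Longrightarrow> b j < n * n" for a
    using marks_eq[of a g] that unfolding b_def by auto
  have Cfree: "C \<subseteq> {i. upper i \<and> ((step 2 ^^ a) g) i = 1} \<and> (\<forall>c\<in>C. deletable ((step 2 ^^ a) g) c)"
    if "\<And>j. j < a \<Longrightarrow> b j < n * n \<and> b j \<notin> C" for a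
  proof -
    have "\<And>c. c \<in> C \<Longrightarrow> ((step 2 ^^ a) g) c = g c" using marks(1)[of a] that by auto
    then show ?thesis using C(1) Cdel marks(4)[of a] that by (auto simp: deletable_def)
  qed
  \<comment> \<open>\<open>C'\<close> is what remains to be deleted after \<open>b a\<close>; it
    will be \<open>C - {b a}\<close>, \<open>{}\<close> or \<open>C - {c}\<close>.\<close>
  have key: "feasible ws l (step 3 ((step 2 ^^ a) g))"
    if pre: "\<And>j. j < a \<Longrightarrow> b j < n * n \<and> b j \<notin> C" and ba: "b a < n * n"
      and C': "C' \<subseteq> C - {b a}" "card C' \<le> l" "sum wt C \<le> wt (b a) + sum wt C'"
        "biconnected {..<n} (edge ` (present g - insert (b a) C'))" for a C'
  proof -
    let ?g = "(step 2 ^^ a) g"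
    have m: "present ?g = present g" "deleted ?g = deleted g" using marks(4,5) pre by auto
    have d: "deletable ?g (b a)" and st: "step 3 ?g = ?g(b a := 3)"
      using best_deletable[of ?g] ba by (auto simp: b_def step_def)
    then have pd: "present (?g(b a := 3)) = present g - {b a}" "deleted (?g(b a := 3)) = insert (b a) (deleted g)"
      "b a \<notin> deleted g"
      using present_delete[of ?g "b a"] m by (auto simp: deletable_def)
    have "C' \<subseteq> {i. upper i \<and> (?g(b a := 3)) i = 1}" using C'(1) Cfree[of a] pre by auto
    moreover have "present (?g(b a := 3)) - C' = present g - insert (b a) C'" using pd by auto
    moreover have "ws \<le> sum wt (deleted (?g(b a := 3))) + sum wt C'"
      using pd C(4) C'(3) finite_deleted by simp
    ultimately show ?thesis unfolding feasible_def st using C'(2,4) by (intro exI[of _ C']) simp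
  qed
  \<comment> \<open>All of \<open>C\<close> would still be deletable, so if nothing is, then
    \<open>C\<close> is empty and doing nothing is right.\<close>
  have stop: "feasible ws l (step 3 ((step 2 ^^ a) g))"
    if pre: "\<And>j. j < a \<Longrightarrow> b j < n * n \<and> b j \<notin> C" and ba: "\<not> b a < n * n" for a
  proof -
    let ?g = "(step 2 ^^ a) g"
    have m: "present ?g = present g" "deleted ?g = deleted g" using marks(4,5)[of a] pre by blast+
    have "\<forall>c\<in>C. deletable ?g c" using Cfree[of a] pre by blast
    moreover have nb: "\<not> best ?g (n * n) < n * n" using ba by (simp add: b_def)
    ultimately have C0: "C = {}" using no_best[OF nb] by blast
    have st: "step 3 ?g = ?g" using nb by (simp add: step_def)
    show ?thesis unfolding feasible_def st m using C(3,4) C0 by (intro exI[of _ "{}"]) simp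
  qed
  show ?thesis
  proof (cases "\<exists>a<N. \<not> (b a < n * n \<and> b a \<notin> C)")
    case True
    define a where "a = (LEAST a. a < N \<and> \<not> (b a < n * n \<and> b a \<notin> C))"
    have a: "a < N" "\<not> (b a < n * n \<and> b a \<notin> C)"
      using LeastI_ex[OF True] unfolding a_def by blast+
    have pre: "b j < n * n \<and> b j \<notin> C" if "j < a" for j
      using not_less_Least[of j "\<lambda>a. a < N \<and> \<not> (b a < n * n \<and> b a \<notin> C)"] that a(1)
      unfolding a_def by linarith
    show ?thesis
    proof (cases "b a < n * n")
      case True
      then have "b a \<in> C" using a by blast
      then have "card (C - {b a}) \<le> l" "sum wt C \<le> wt (b a) + sum wt (C - {b a})" "insert (b a) (C - {b a}) = C"
        using C(2) finC by (auto simp: sum.remove)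
      then show ?thesis using key[OF pre True, of "C - {b a}"] C(3) a(1) by auto
    next
      case False
      then show ?thesis using stop pre a(1) by blast
    qed
  next
    case False
    then have all: "\<And>j. j < N \<Longrightarrow> b j < n * n \<and> b j \<notin> C" by blast
    note mN = marks[of N]
    have bdel: "deletable g (b j)" if "j < N" for j using mN(3) all that by blast
    have "0 < N" using N by simp
    show ?thesis
    proof (cases "C = {}")
      case True
      \<comment> \<open>An exchange needs something to give back. With \<open>C = {}\<close> there
        is budget left instead, and deleting the first cell loses nothing since weights are
        nonnegative.\<close>
      have "biconnected {..<n} (edge ` (present g - {b 0}))" "0 \<le> wt (b 0)"
        using bdel[OF \<open>0 < N\<close>] wt by (auto simp: deletable_def)
      then have "feasible ws l (step 3 ((step 2 ^^ 0) g))"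
        using True all[OF \<open>0 < N\<close>] by (intro key[of 0 "{}"]) auto
      then show ?thesis using \<open>0 < N\<close> by blast
    next
      case False
      define H where "H = edge ` b ` {..<N}"
      let ?T = "edge ` (present g - C)" and ?S = "edge ` C"
      have CP: "C \<subseteq> present g" using C(1) by (auto simp: present_def)
      have bP: "b j \<in> present g" if "j < N" for j using bdel[OF that] by (auto simp: deletable_def present_def)
      have inj: "inj_on edge (present g)" using inj_on_edge present_upper inj_on_subset by blast
      have un: "?T \<union> ?S = edge ` present g" using CP by auto
      have cH: "card H = N"
      proof -
        have "inj_on edge (b ` {..<N})" using inj by (rule inj_on_subset) (use bP in auto)
        then have "card H = card (b ` {..<N})" unfolding H_def by (rule card_image)
        also have "\<dots> = N" using mN(2) all by (simp add: card_image)
        finally show ?thesis .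
      qed
      have cS: "card ?S \<le> Suc l" using C(2) card_image_le[OF finC, of edge] by simp
      have HT: "H \<subseteq> ?T" using all bP by (auto simp: H_def)
      have disj: "?S \<inter> ?T = {}" using CP inj by (auto dest: inj_onD)
      have Hdel: "biconnected {..<n} (?T \<union> ?S - {h})" if hH: "h \<in> H" for h
      proof -
        obtain j where j: "j < N" "h = edge (b j)" using hH by (auto simp: H_def)
        have "edge ` present g - {h} = edge ` (present g - {b j})"
          using inj_on_image_set_diff[OF inj, of "present g" "{b j}"] j bP by auto
        then show ?thesis using bdel[OF j(1)] un by (simp add: deletable_def)
      qed
      have "(card ?S)\<^sup>2 \<le> (Suc l)\<^sup>2" using cS by (rule power_mono) simp
      then have big: "4 * (card ?S)\<^sup>2 < card H" using N cH by linarith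
      have sg: "simple_graph {..<n} (?T \<union> ?S)" unfolding un by (rule simple_graph_edges[OF present_upper])
      obtain h s where hs: "h \<in> H" "s \<in> ?S" "biconnected {..<n} (insert s ?T - {h})"
        by (rule biconnected_exchange[OF sg C(3) HT Hdel big]) (use False disj finC in auto)
      obtain a where a: "a < N" "h = edge (b a)" using hs(1) by (auto simp: H_def)
      obtain c where c: "c \<in> C" "s = edge c" using hs(2) by auto
      have bi: "insert s ?T - {h} = edge ` (present g - insert (b a) (C - {c}))"
      proof -
        have "insert s ?T = edge ` (present g - (C - {c}))" using c CP by auto
        moreover have "\<dots> - {h} = edge ` (present g - (C - {c}) - {b a})"
          using inj_on_image_set_diff[OF inj, of "present g - (C - {c})" "{b a}"] a bP by auto
        moreover have "present g - (C - {c}) - {b a} = present g - insert (b a) (C - {c})" by auto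
        ultimately show ?thesis by simp
      qed
      have pre: "b j < n * n \<and> b j \<notin> C" if "j < a" for j
        using all[of j] that a(1) by linarith
      have "deletable ((step 2 ^^ a) g) c" using Cfree[OF pre] c(1) by blast
      then have wc: "wt c \<le> wt (b a)"
        using best_deletable(2)[of "(step 2 ^^ a) g" c] all[OF a(1)] by (simp add: b_def)
      have sc: "sum wt C = wt c + sum wt (C - {c})" "card (C - {c}) \<le> l"
        using c(1) finC C(2) by (auto simp: sum.remove)
      have "feasible ws l (step 3 ((step 2 ^^ a) g))"
      proof (rule key[OF pre])
        show "C - {c} \<subseteq> C - {b a}" "b a < n * n" using all[OF a(1)] by auto
        show "sum wt C \<le> wt (b a) + sum wt (C - {c})" using sc wc by simp
        show "biconnected {..<n} (edge ` (present g - insert (b a) (C - {c})))" using hs(3) bi by simp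
      qed (auto simp: sc(2))
      then show ?thesis using a(1) by blast
    qed
  qed
qed

lemma wt_step:
  assumes "\<And>i. upper i \<Longrightarrow> g i = 1 \<Longrightarrow> 0 \<le> wt i" "s \<noteq> 1" "upper i" "step s g i = 1"
  shows "0 \<le> wt i"
  using assms by (auto simp: step_def split: if_splits)

lemma wt_steps:
  assumes "\<And>i. upper i \<Longrightarrow> g i = 1 \<Longrightarrow> 0 \<le> wt i" "upper i" "(step 2 ^^ a) g i = 1"
  shows "0 \<le> wt i"
  using assms(2,3)
proof (induction a arbitrary: i)
  case 0
  then show ?case using assms(1) by simp
next
  case (Suc a)
  then show ?case using wt_step[of "(step 2 ^^ a) g" 2 i] by simp
qed

text \<open>The numbers of cells passed over become the digits of \<open>t\<close>, the first one
  being the least significant. One base \<open>N\<close> serves all levels, as the remaining budget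
  only shrinks.\<close>

lemma feasible_search:
  assumes "feasible ws l g" "4 * l\<^sup>2 < N" "\<And>i. upper i \<Longrightarrow> g i = 1 \<Longrightarrow> 0 \<le> wt i"
  shows "\<exists>t<N ^ l. feasible ws 0 (search l t g)"
  using assms
proof (induction l arbitrary: g)
  case (Suc l)
  obtain a where a: "a < N" "feasible ws l (step 3 ((step 2 ^^ a) g))"
    using feasible_step[OF Suc.prems] by blast
  have "l\<^sup>2 \<le> (Suc l)\<^sup>2" by (rule power_mono) simp_all
  then have "4 * l\<^sup>2 < N" using Suc.prems(2) by linarith
  moreover have "0 \<le> wt i" if "upper i" "step 3 ((step 2 ^^ a) g) i = 1" for i
    using wt_step[OF _ _ that] wt_steps[OF Suc.prems(3)] by simp
  ultimately obtain t where t: "t < N ^ l" "feasible ws 0 (search l t (step 3 ((step 2 ^^ a) g)))"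
    using Suc.IH[OF a(2)] by blast
  have "a + N * t < N ^ Suc l"
  proof -
    have "a + N * t < N * Suc t" using a(1) by simp
    also have "\<dots> \<le> N * N ^ l" using t(1) by (intro mult_le_mono2) simp
    finally show ?thesis by simp
  qed
  moreover have "search (Suc l) (a + N * t) g = search l t (step 3 ((step 2 ^^ a) g))"
    using a(1) by simp
  ultimately show ?case using t(2) by metis
qed (auto intro: exI[of _ 0])

end

section \<open>A program logic for the machine\<close>

text \<open>
  Cell 0 of the natural memory holds the base address \<open>n * n + 2\<close> of a frame consisting of 32
  registers followed by an array of vertex marks. The adjacency matrix stays where the input
  put it and doubles as the array of cell states. The real cell at the base address accumulates
  the weight of the deleted edges.
\<close>

definition Reg :: "nat \<Rightarrow> nexp" where
  "Reg j = NLoad (NAdd (NLoad (NConst 0)) (NConst j))"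

definition SetReg :: "nat \<Rightarrow> nexp \<Rightarrow> com" where
  "SetReg j e = NStore (NAdd (NLoad (NConst 0)) (NConst j)) e"

definition Mark :: "nexp \<Rightarrow> nexp" where
  "Mark e = NLoad (NAdd (NAdd (NLoad (NConst 0)) (NConst 32)) e)"

definition SetMark :: "nexp \<Rightarrow> nexp \<Rightarrow> com" where
  "SetMark e e' = NStore (NAdd (NAdd (NLoad (NConst 0)) (NConst 32)) e) e'"

definition Cell :: "nexp \<Rightarrow> nexp" where
  "Cell e = NLoad (NAdd (NConst 2) e)"

definition SetCell :: "nexp \<Rightarrow> nexp \<Rightarrow> com" where
  "SetCell e e' = NStore (NAdd (NConst 2) e) e'"

definition Weight :: "nexp \<Rightarrow> rexp" where
  "Weight e = RLoad (NAdd (NConst 1) e)"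

definition Acc :: rexp where
  "Acc = RLoad (NLoad (NConst 0))"

definition SetAcc :: "rexp \<Rightarrow> com" where
  "SetAcc e = RStore (NLoad (NConst 0)) e"

definition BNeq :: "nexp \<Rightarrow> nexp \<Rightarrow> bexp" where
  "BNeq a b = BNot (BAnd (BNot (NLess a b)) (BNot (NLess b a)))"

definition For :: "nat \<Rightarrow> nexp \<Rightarrow> com \<Rightarrow> com" where
  "For j b p = Seq (SetReg j (NConst 0))
     (While (NLess (Reg j) b) (Seq p (SetReg j (NAdd (Reg j) (NConst 1)))))"

text \<open>The machine cannot divide, so \<open>u\<close> and \<open>v\<close> are counted along as
  row and column of cell \<open>i\<close>.\<close>

definition Cells :: "nat \<Rightarrow> nat \<Rightarrow> nat \<Rightarrow> com \<Rightarrow> com" where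
  "Cells i u v p = Seq (SetReg u (NConst 0)) (Seq (SetReg v (NConst 0))
     (For i (Reg 1) (Seq p (Seq (SetReg v (NAdd (Reg v) (NConst 1)))
       (Ite (NLess (Reg v) (Reg 0)) Skip
         (Seq (SetReg v (NConst 0)) (SetReg u (NAdd (Reg u) (NConst 1)))))))))"

lemma ncost_macros [simp]:
  "ncost (Reg j) = 5" "ncost (Mark e) = 6 + ncost e" "ncost (Cell e) = 3 + ncost e"
  "rcost (Weight e) = 3 + ncost e" "rcost Acc = 3" "bcost (BNeq a b) = 6 + 2 * ncost a + 2 * ncost b"
  by (simp_all add: Reg_def Mark_def Cell_def Weight_def Acc_def BNeq_def)

lemma bval_BNeq [simp]: "bval (BNeq a b) m \<longleftrightarrow> nval a m \<noteq> nval b m"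
  by (auto simp: BNeq_def)

record state =
  reg :: "nat \<Rightarrow> nat"
  mark :: "nat \<Rightarrow> nat"
  cell :: "nat \<Rightarrow> nat"
  acc :: real

abbreviation upd :: "state \<Rightarrow> nat \<Rightarrow> nat \<Rightarrow> state" where
  "upd s j v \<equiv> s\<lparr>reg := (reg s)(j := v)\<rparr>"

definition same_regs :: "nat set \<Rightarrow> state \<Rightarrow> state \<Rightarrow> bool" where
  "same_regs K s s' \<longleftrightarrow> (\<forall>j. j \<notin> K \<longrightarrow> reg s' j = reg s j)"

text \<open>A coarse bound for \<open>For\<close>: each 100 covers the test and the counter updates
  as long as the bound expression costs at most 40.\<close>

definition for_time :: "nat \<Rightarrow> nat \<Rightarrow> nat" where
  "for_time m T = m * (T + 100) + 100"

locale ram = cell_search n wt N for n wt N +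
  fixes k0 :: nat and R :: "nat \<Rightarrow> real"
  assumes n2: "2 \<le> n" and wt_R: "\<And>i. i < n * n \<Longrightarrow> R (Suc i) = wt i"
begin

text \<open>The first natural address after the input. It also lies beyond the weights, which end at
  real address \<open>n * n\<close>, so the accumulator overwrites none of them.\<close>

definition base :: nat where "base = n * n + 2"

definition mem :: "state \<Rightarrow> memory" where
  "mem s = (\<lambda>a. if a = 0 then base else if a = 1 then k0 else if a < base then cell s (a - 2)
       else if a < base + 32 then reg s (a - base) else mark s (a - (base + 32)),
     \<lambda>a. if a = base then acc s else R a)"

text \<open>Total correctness with a time bound. Since the final memory must be some
  \<open>mem s'\<close>, each rule accounts for the address that it writes.\<close>

definition wp :: "com \<Rightarrow> (state \<Rightarrow> bool) \<Rightarrow> nat \<Rightarrow> state \<Rightarrow> bool" where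
  "wp p Q T s \<longleftrightarrow> (\<exists>t s'. runs p (mem s) t (mem s') \<and> t \<le> T \<and> Q s')"

lemma fst_mem0 [simp]: "fst (mem s) 0 = base" by (simp add: mem_def)

lemma nval_Reg [simp]: "j < 32 \<Longrightarrow> nval (Reg j) (mem s) = reg s j"
  by (simp add: Reg_def mem_def base_def)

lemma nval_Mark [simp]: "nval (Mark e) (mem s) = mark s (nval e (mem s))"
  by (simp add: Mark_def) (simp add: mem_def base_def)

lemma nval_Cell: "nval e (mem s) < n * n \<Longrightarrow> nval (Cell e) (mem s) = cell s (nval e (mem s))"
  by (simp add: Cell_def) (simp add: mem_def base_def)

lemma rval_Weight: "nval e (mem s) < n * n \<Longrightarrow> rval (Weight e) (mem s) = wt (nval e (mem s))"
  by (simp add: Weight_def) (simp add: mem_def base_def wt_R)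

lemma rval_Acc [simp]: "rval Acc (mem s) = acc s"
  by (simp add: Acc_def) (simp add: mem_def)

lemma rval_0: "rval (RLoad (NConst 0)) (mem s) = R 0"
  by (simp add: mem_def base_def)

lemma wp_weaken: "wp p Q T s \<Longrightarrow> T \<le> T' \<Longrightarrow> wp p Q T' s"
  unfolding wp_def by (meson le_trans)

lemma wp_conseq: "wp p Q T s \<Longrightarrow> (\<And>s'. Q s' \<Longrightarrow> Q' s') \<Longrightarrow> wp p Q' T s"
  unfolding wp_def by blast

lemma wp_Skip: "Q s \<Longrightarrow> wp Skip Q 1 s"
  unfolding wp_def using runs.Skip by blast

lemma wp_Seq: "wp p (wp q Q T2) T1 s \<Longrightarrow> wp (Seq p q) Q (T1 + T2) s"
  unfolding wp_def by (meson runs.Seq add_mono)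

lemma wp_Ite:
  assumes "bval b (mem s) \<Longrightarrow> wp p Q T1 s" "\<not> bval b (mem s) \<Longrightarrow> wp q Q T2 s"
  shows "wp (Ite b p q) Q (1 + bcost b + T1 + T2) s"
proof (cases "bval b (mem s)")
  case True
  then obtain t s' where "runs p (mem s) t (mem s')" "t \<le> T1" "Q s'" using assms(1) unfolding wp_def by blast
  then show ?thesis unfolding wp_def using IteTrue[OF True] by (intro exI[of _ "1 + bcost b + t"]) fastforce
next
  case False
  then obtain t s' where "runs q (mem s) t (mem s')" "t \<le> T2" "Q s'" using assms(2) unfolding wp_def by blast
  then show ?thesis unfolding wp_def using IteFalse[OF False] by (intro exI[of _ "1 + bcost b + t"]) fastforce
qed

lemma wp_NStore:
  assumes "((fst (mem s))(nval a (mem s) := nval e (mem s)), snd (mem s)) = mem s'" "Q s'"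
  shows "wp (NStore a e) Q (1 + ncost a + ncost e) s"
  unfolding wp_def using runs.NStore[of a e "mem s"] assms by auto

lemma wp_SetReg:
  assumes "j < 32" "Q (upd s j (nval e (mem s)))"
  shows "wp (SetReg j e) Q (5 + ncost e) s"
proof -
  have "wp (SetReg j e) Q (1 + ncost (NAdd (NLoad (NConst 0)) (NConst j)) + ncost e) s"
    unfolding SetReg_def
    by (rule wp_NStore[where s' = "upd s j (nval e (mem s))"])
      (use assms in \<open>auto simp: mem_def base_def fun_eq_iff\<close>)
  then show ?thesis by (rule wp_weaken) simp
qed

lemma wp_SetMark:
  assumes "Q (s\<lparr>mark := (mark s)(nval a (mem s) := nval e (mem s))\<rparr>)"
  shows "wp (SetMark a e) Q (6 + ncost a + ncost e) s"
proof -
  have "wp (SetMark a e) Q (1 + ncost (NAdd (NAdd (NLoad (NConst 0)) (NConst 32)) a) + ncost e) s"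
    unfolding SetMark_def
    by (rule wp_NStore[where s' = "s\<lparr>mark := (mark s)(nval a (mem s) := nval e (mem s))\<rparr>"])
      (use assms in \<open>auto simp: mem_def base_def fun_eq_iff\<close>)
  then show ?thesis by (rule wp_weaken) simp
qed

lemma wp_SetCell:
  assumes "nval a (mem s) < n * n" "Q (s\<lparr>cell := (cell s)(nval a (mem s) := nval e (mem s))\<rparr>)"
  shows "wp (SetCell a e) Q (3 + ncost a + ncost e) s"
proof -
  have "wp (SetCell a e) Q (1 + ncost (NAdd (NConst 2) a) + ncost e) s"
    unfolding SetCell_def
    by (rule wp_NStore[where s' = "s\<lparr>cell := (cell s)(nval a (mem s) := nval e (mem s))\<rparr>"])
      (use assms in \<open>auto simp: mem_def base_def fun_eq_iff\<close>)
  then show ?thesis by (rule wp_weaken) simp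
qed

lemma wp_SetAcc:
  assumes "Q (s\<lparr>acc := rval e (mem s)\<rparr>)"
  shows "wp (SetAcc e) Q (3 + rcost e) s"
proof -
  have eq: "(fst (mem s), (snd (mem s))(nval (NLoad (NConst 0)) (mem s) := rval e (mem s))) = mem (s\<lparr>acc := rval e (mem s)\<rparr>)"
    by (auto simp: mem_def fun_eq_iff)
  have "runs (SetAcc e) (mem s) (1 + ncost (NLoad (NConst 0)) + rcost e) (mem (s\<lparr>acc := rval e (mem s)\<rparr>))"
    unfolding SetAcc_def eq[symmetric] by (rule runs.RStore)
  then show ?thesis unfolding wp_def using assms by fastforce
qed

lemma wp_While:
  assumes inv: "\<And>i s. i < m \<Longrightarrow> I i s \<Longrightarrow> bval b (mem s) \<and> wp p (I (Suc i)) T s"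
    and exit: "\<And>s. I m s \<Longrightarrow> \<not> bval b (mem s) \<and> Q s" and "I 0 s"
  shows "wp (While b p) Q (m * (T + 1 + bcost b) + 1 + bcost b) s"
proof -
  have "wp (While b p) Q (d * (T + 1 + bcost b) + 1 + bcost b) s" if "d \<le> m" "I (m - d) s" for d s
    using that
  proof (induction d arbitrary: s)
    case 0
    then show ?case unfolding wp_def using exit[of s] WhileFalse[of b "mem s" p] by auto
  next
    case (Suc d)
    have "m - Suc d < m" and "Suc (m - Suc d) = m - d" using Suc.prems(1) by auto
    then have b: "bval b (mem s)" and "wp p (I (m - d)) T s" using inv[of "m - Suc d" s] Suc.prems(2) by auto
    then obtain t s' where 1: "runs p (mem s) t (mem s')" "t \<le> T" "I (m - d) s'" unfolding wp_def by blast
    obtain t' s'' where 2: "runs (While b p) (mem s') t' (mem s'')" "Q s''"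
      "t' \<le> d * (T + 1 + bcost b) + 1 + bcost b"
      using Suc.IH[of s'] 1(3) Suc.prems(1) unfolding wp_def by auto
    show ?case unfolding wp_def
      using WhileTrue[OF b 1(1) 2(1)] 1(2) 2(2,3) by (intro exI[of _ "1 + bcost b + t + t'"] exI[of _ s'']) simp
  qed
  from this[of m s] show ?thesis using assms(3) by simp
qed

text \<open>The invariant has to be independent of the loop register, so that incrementing it
  preserves \<open>I\<close>. The value of the counter is tracked separately, by
  \<open>reg s j = i\<close> before and after the body.\<close>

lemma wp_For:
  assumes j: "j < 32" and b: "ncost b \<le> 40"
    and stable: "\<And>i s v. I i s \<Longrightarrow> I i (upd s j v)"
    and bound: "\<And>i s. I i s \<Longrightarrow> nval b (mem s) = m"
    and init: "I 0 s"
    and body: "\<And>i s. i < m \<Longrightarrow> I i s \<Longrightarrow> reg s j = i \<Longrightarrow> wp p (\<lambda>s'. reg s' j = i \<and> I (Suc i) s') T s"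
    and fin: "\<And>s. I m s \<Longrightarrow> Q s"
  shows "wp (For j b p) Q (for_time m T) s"
proof -
  let ?I = "\<lambda>i s. I i s \<and> reg s j = i"
  have "wp (For j b p) Q (6 + (m * (T + 12 + 1 + (6 + ncost b)) + 1 + (6 + ncost b))) s"
    unfolding For_def
  proof (rule wp_weaken[OF wp_Seq[OF wp_SetReg]])
    show "wp (While (NLess (Reg j) b) (Seq p (SetReg j (NAdd (Reg j) (NConst 1))))) Q
        (m * (T + 12 + 1 + bcost (NLess (Reg j) b)) + 1 + bcost (NLess (Reg j) b)) (upd s j (nval (NConst 0) (mem s)))"
    proof (rule wp_While[where I = ?I])
      fix i s assume i: "i < m" "?I i s"
      have "wp p (wp (SetReg j (NAdd (Reg j) (NConst 1))) (?I (Suc i)) 12) T s"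
      proof (rule wp_conseq[OF body[OF i(1)]])
        fix s' assume s': "reg s' j = i \<and> I (Suc i) s'"
        have "?I (Suc i) (upd s' j (nval (NAdd (Reg j) (NConst 1)) (mem s')))"
          using s' stable[of "Suc i" s'] j by simp
        from wp_SetReg[OF j, of "?I (Suc i)", OF this]
        show "wp (SetReg j (NAdd (Reg j) (NConst 1))) (?I (Suc i)) 12 s'" by simp
      qed (use i in auto)
      from wp_Seq[OF this]
      have "wp (Seq p (SetReg j (NAdd (Reg j) (NConst 1)))) (?I (Suc i)) (T + 12) s" .
      then show "bval (NLess (Reg j) b) (mem s) \<and> wp (Seq p (SetReg j (NAdd (Reg j) (NConst 1)))) (?I (Suc i)) (T + 12) s"
        using i j bound[OF conjunct1[OF i(2)]] by simp
    next
      fix s assume "?I m s"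
      then show "\<not> bval (NLess (Reg j) b) (mem s) \<and> Q s" using j bound[of m s] fin[of s] by simp
    next
      show "?I 0 (upd s j (nval (NConst 0) (mem s)))" using stable[OF init] by simp
    qed
  qed (use j in auto)
  moreover have "6 + (m * (T + 12 + 1 + (6 + ncost b)) + 1 + (6 + ncost b)) \<le> for_time m T"
    proof -
    have "m * (T + 12 + 1 + (6 + ncost b)) \<le> m * (T + 100)" using b by (intro mult_le_mono) auto
    then show ?thesis using b unfolding for_time_def by linarith
  qed
  ultimately show ?thesis by (rule wp_weaken)
qed

end

section \<open>The program\<close>

text \<open>
  Registers: 0--4 hold \<open>n\<close>, \<open>n * n\<close>, \<open>k\<close>, \<open>N = 4 * k\<^sup>2 + 1\<close> and \<open>N ^ k\<close>; 5 the branch \<open>t\<close>; 6 the answer;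
  7 and 8 the remaining digits of \<open>t\<close>; 9 and 10 loop counters; 11 the best cell; 12--14 the
  candidate cell with its row and column; 15 the outcome of the biconnectivity test, in which
  the candidate cell counts as absent; 16 the deleted vertex, where \<open>n\<close> stands for none; 17--21
  the counters of the test; 22 and 23 are temporary. The test starts its search at vertex 0, or
  at vertex 1 if vertex 0 is deleted.
\<close>

definition Relax :: com where
  "Relax = Ite (BAnd (NLess (Reg 20) (Reg 21)) (BAnd (NLess (NConst 0) (Cell (Reg 19)))
       (BAnd (NLess (Cell (Reg 19)) (NConst 3)) (BAnd (BNeq (Reg 19) (Reg 12))
       (BAnd (BNeq (Reg 20) (Reg 16)) (BNeq (Reg 21) (Reg 16)))))))
     (Ite (NLess (NConst 0) (Mark (Reg 20))) (SetMark (Reg 21) (NConst 1))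
       (Ite (NLess (NConst 0) (Mark (Reg 21))) (SetMark (Reg 20) (NConst 1)) Skip)) Skip"

definition Connected :: com where
  "Connected = Seq (For 18 (Reg 0) (SetMark (Reg 18) (NConst 0)))
     (Seq (Ite (NLess (NConst 0) (Reg 16)) (SetMark (NConst 0) (NConst 1)) (SetMark (NConst 1) (NConst 1)))
     (Seq (For 17 (Reg 0) (Cells 19 20 21 Relax))
       (For 18 (Reg 0) (Ite (BAnd (BNeq (Reg 18) (Reg 16)) (NLess (Mark (Reg 18)) (NConst 1)))
          (SetReg 15 (NConst 0)) Skip))))"

definition Biconnected :: com where
  "Biconnected = Seq (SetReg 15 (NConst 1)) (For 16 (NAdd (Reg 0) (NConst 1)) Connected)"

definition cells_time :: "nat \<Rightarrow> nat \<Rightarrow> nat" where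
  "cells_time n T = for_time (n * n) (T + 100) + 12"

definition connected_time :: "nat \<Rightarrow> nat" where
  "connected_time n = for_time n 100 + (100 + (for_time n (cells_time n 300) + for_time n 100))"

definition biconnected_time :: "nat \<Rightarrow> nat" where
  "biconnected_time n = 6 + for_time (n + 1) (connected_time n)"

text \<open>Reachability is symmetric, so for each \<open>c\<close> one start vertex suffices to
  compare all pairs. Deleting \<open>c = n\<close> changes nothing and yields connectedness.\<close>

lemma biconnected_iff_reachable:
  fixes n :: nat
  assumes sg: "simple_graph {..<n} E" and n: "2 \<le> n"
  shows "biconnected {..<n} E \<longleftrightarrow>
    (\<forall>c\<le>n. \<forall>a<n. a \<noteq> c \<longrightarrow> (if 0 < c then 0 else 1, a) \<in> (adjacency (delete_vertex E c))\<^sup>*)"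
proof
  assume bi: "biconnected {..<n} E"
  have con: "\<And>u v. u < n \<Longrightarrow> v < n \<Longrightarrow> (u, v) \<in> (adjacency E)\<^sup>*"
    using bi by (auto simp: biconnected_def connected_graph_def)
  have nocut: "\<not> cut_vertex {..<n} E c" for c using bi by (simp add: biconnected_def)
  show "\<forall>c\<le>n. \<forall>a<n. a \<noteq> c \<longrightarrow> (if 0 < c then 0 else 1, a) \<in> (adjacency (delete_vertex E c))\<^sup>*"
  proof (intro allI impI)
    fix c a :: nat
    assume ca: "c \<le> n" "a < n" "a \<noteq> c"
    let ?s = "if 0 < c then 0 else 1 :: nat"
    have s: "?s < n" "?s \<noteq> c" using n by auto
    show "(?s, a) \<in> (adjacency (delete_vertex E c))\<^sup>*"
    proof (cases "c < n")
      case True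
      then show ?thesis using nocut[of c] con[OF s(1) ca(2)] s ca unfolding cut_vertex_def by blast
    next
      case False
      then have "delete_vertex E c = E" using ca sg by (auto simp: delete_vertex_def simple_graph_def)
      then show ?thesis using con[OF s(1) ca(2)] by simp
    qed
  qed
next
  assume *: "\<forall>c\<le>n. \<forall>a<n. a \<noteq> c \<longrightarrow> (if 0 < c then 0 else 1, a) \<in> (adjacency (delete_vertex E c))\<^sup>*"
  have both: "(x, y) \<in> (adjacency (delete_vertex E c))\<^sup>*" if "c \<le> n" "x < n" "y < n" "x \<noteq> c" "y \<noteq> c" for c x y
  proof -
    have "sym (adjacency (delete_vertex E c))" by (auto simp: sym_def adjacency_def insert_commute)
    then have "sym ((adjacency (delete_vertex E c))\<^sup>*)" by (rule sym_rtrancl)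
    moreover have "(if 0 < c then 0 else 1, x) \<in> (adjacency (delete_vertex E c))\<^sup>*"
      "(if 0 < c then 0 else 1, y) \<in> (adjacency (delete_vertex E c))\<^sup>*" using * that by blast+
    ultimately show ?thesis by (blast dest: symD intro: rtrancl_trans)
  qed
  have "delete_vertex E n = E" using sg by (auto simp: delete_vertex_def simple_graph_def)
  then have "connected_graph {..<n} E" using both[of n] n
    by (auto simp: connected_graph_def lessThan_empty_iff)
  moreover have "\<not> cut_vertex {..<n} E v" for v using both[of v] by (auto simp: cut_vertex_def)
  ultimately show "biconnected {..<n} E" using n by (simp add: biconnected_def)
qed

text \<open>
  Meaningful for loop-free programs only.
\<close>

primrec straight_time :: "com \<Rightarrow> nat" where
  "straight_time Skip = 1"
| "straight_time (NStore a e) = 1 + ncost a + ncost e"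
| "straight_time (RStore a e) = 1 + ncost a + rcost e"
| "straight_time (Seq p q) = straight_time p + straight_time q"
| "straight_time (Ite b p q) = 1 + bcost b + straight_time p + straight_time q"
| "straight_time (While b p) = 0"

lemma straight_time_macros [simp]:
  "straight_time (SetReg j e) = 5 + ncost e" "straight_time (SetMark a e) = 6 + ncost a + ncost e"
  "straight_time (SetCell a e) = 3 + ncost a + ncost e" "straight_time (SetAcc re) = 3 + rcost re"
  by (simp_all add: SetReg_def SetMark_def SetCell_def SetAcc_def)

context ram
begin

text \<open>With the time fixed by the program text, the rules contain no time variable:
  \<open>intro\<close> executes loop-free code symbolically, and its cost is checked once at the
  end.\<close>

definition straight :: "com \<Rightarrow> (state \<Rightarrow> bool) \<Rightarrow> state \<Rightarrow> bool" where
  "straight p Q s \<longleftrightarrow> wp p Q (straight_time p) s"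

lemma straight_rules:
  "Q s \<Longrightarrow> straight Skip Q s"
  "straight p (straight q Q) s \<Longrightarrow> straight (Seq p q) Q s"
  "(bval b (mem s) \<Longrightarrow> straight p Q s) \<Longrightarrow> (\<not> bval b (mem s) \<Longrightarrow> straight q Q s) \<Longrightarrow> straight (Ite b p q) Q s"
  "j < 32 \<Longrightarrow> Q (upd s j (nval e (mem s))) \<Longrightarrow> straight (SetReg j e) Q s"
  "Q (s\<lparr>mark := (mark s)(nval a (mem s) := nval e (mem s))\<rparr>) \<Longrightarrow> straight (SetMark a e) Q s"
  "nval a (mem s) < n * n \<Longrightarrow> Q (s\<lparr>cell := (cell s)(nval a (mem s) := nval e (mem s))\<rparr>) \<Longrightarrow> straight (SetCell a e) Q s"
  "Q (s\<lparr>acc := rval re (mem s)\<rparr>) \<Longrightarrow> straight (SetAcc re) Q s"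
  unfolding straight_def straight_time_macros straight_time.simps
  by (fact wp_Skip, rule wp_Seq, assumption, rule wp_Ite, assumption, assumption,
    fact wp_SetReg, fact wp_SetMark, fact wp_SetCell, fact wp_SetAcc)

lemma wp_straight: "straight p Q s \<Longrightarrow> straight_time p \<le> T \<Longrightarrow> wp p Q T s"
  unfolding straight_def by (rule wp_weaken)

lemma wp_straight_Seq:
  "straight p (wp q Q T) s \<Longrightarrow> straight_time p + T \<le> T' \<Longrightarrow> wp (Seq p q) Q T' s"
  unfolding straight_def by (rule wp_weaken[OF wp_Seq])

lemma wp_Cells:
  assumes r: "i < 32" "u < 32" "v < 32" "i \<noteq> u" "i \<noteq> v" "u \<noteq> v" "1 < i" "1 < u" "1 < v"
    and stable: "\<And>m s f. I m s \<Longrightarrow> (\<And>j. j \<notin> {i, u, v} \<Longrightarrow> f j = reg s j) \<Longrightarrow> I m (s\<lparr>reg := f\<rparr>)"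
    and bound: "\<And>m s. I m s \<Longrightarrow> reg s 0 = n \<and> reg s 1 = n * n"
    and init: "I 0 s"
    and body: "\<And>m s. m < n * n \<Longrightarrow> I m s \<Longrightarrow> reg s i = m \<Longrightarrow> reg s u = m div n \<Longrightarrow> reg s v = m mod n \<Longrightarrow>
      wp p (\<lambda>s'. I (Suc m) s' \<and> reg s' i = m \<and> reg s' u = m div n \<and> reg s' v = m mod n) T s"
    and fin: "\<And>s. I (n * n) s \<Longrightarrow> Q s"
  shows "wp (Cells i u v p) Q (cells_time n T) s"
proof -
  let ?J = "\<lambda>m s. I m s \<and> reg s u = m div n \<and> reg s v = m mod n"
  let ?next = "Seq (SetReg v (NAdd (Reg v) (NConst 1)))
       (Ite (NLess (Reg v) (Reg 0)) Skip (Seq (SetReg v (NConst 0)) (SetReg u (NAdd (Reg u) (NConst 1)))))"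
  have next_cell: "wp ?next (\<lambda>s'. reg s' i = m \<and> ?J (Suc m) s') 100 s"
    if "m < n * n" "I (Suc m) s" "reg s i = m" "reg s u = m div n" "reg s v = m mod n" for m s
  proof -
    have le: "Suc (m mod n) \<le> n" using n2 by (simp add: Suc_leI)
    show ?thesis
      by (rule wp_straight, intro straight_rules)
        (use that le r n2 bound[of "Suc m" s] in \<open>auto intro!: stable simp: div_Suc mod_Suc split: if_splits\<close>)
  qed
  let ?loop = "For i (Reg 1) (Seq p ?next)"
  let ?s1 = "upd (upd s u 0) v 0"
  have "wp ?loop Q (for_time (n * n) (T + 100)) ?s1"
  proof (rule wp_For[where I = ?J])
    show "?J 0 ?s1" using r init by (auto intro!: stable split: if_splits)
    fix m s assume m: "m < n * n" "?J m s" "reg s i = m"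
    show "wp (Seq p ?next) (\<lambda>s'. reg s' i = m \<and> ?J (Suc m) s') (T + 100) s"
      by (rule wp_Seq, rule wp_conseq[OF body[OF m(1)]]) (use m next_cell in auto)
  qed (use r bound fin in \<open>auto intro!: stable split: if_splits\<close>)
  note loop = this
  have v: "wp (Seq (SetReg v (NConst 0)) ?loop) Q (6 + for_time (n * n) (T + 100)) (upd s u 0)"
    by (rule wp_straight_Seq[where T = "for_time (n * n) (T + 100)"], rule straight_rules(4)) (use r loop in auto)
  show ?thesis unfolding Cells_def
    by (rule wp_straight_Seq[where T = "6 + for_time (n * n) (T + 100)"], rule straight_rules(4))
      (use r v in \<open>auto simp: cells_time_def\<close>)
qed

section \<open>Marking reachable vertices\<close>

definition marked :: "(nat \<Rightarrow> nat) \<Rightarrow> nat set" where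
  "marked r = {v. v < n \<and> 0 < r v}"

definition relax :: "nat set \<Rightarrow> nat \<Rightarrow> nat \<Rightarrow> (nat \<Rightarrow> nat) \<Rightarrow> nat \<Rightarrow> nat" where
  "relax C c m r = (if m \<in> C \<and> c \<notin> edge m then
     if 0 < r (m div n) then r(m mod n := 1) else if 0 < r (m mod n) then r(m div n := 1) else r else r)"

lemma wp_Relax:
  assumes "m < n * n" "reg s 19 = m" "reg s 20 = m div n" "reg s 21 = m mod n"
  shows "wp Relax (\<lambda>s'. s' = s\<lparr>mark := relax (present (cell s) - {reg s 12}) (reg s 16) m (mark s)\<rparr>) 300 s"
proof -
  have "nval (Cell (Reg 19)) (mem s) = cell s m" using assms by (simp add: nval_Cell)
  note eqs = this assms
  show ?thesis unfolding Relax_def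
    by (rule wp_straight, intro straight_rules)
      (use eqs in \<open>auto simp: relax_def present_def upper_def edge_def\<close>)
qed

lemma marked_relax:
  assumes "C \<subseteq> {i. upper i}"
  shows "marked (relax C c m r) =
    (if m \<in> C \<and> c \<notin> edge m \<and> edge m \<inter> marked r \<noteq> {} then marked r \<union> edge m else marked r)"
  using assms upper_bounds[of m] by (auto simp: marked_def relax_def edge_def)

definition closed_marks :: "nat set \<Rightarrow> nat \<Rightarrow> nat set \<Rightarrow> bool" where
  "closed_marks C c M \<longleftrightarrow> (\<forall>j\<in>C. c \<notin> edge j \<longrightarrow> edge j \<inter> M \<noteq> {} \<longrightarrow> edge j \<subseteq> M)"

definition reach :: "nat set \<Rightarrow> nat \<Rightarrow> nat set" where
  "reach C c = {z. (if 0 < c then 0 else 1, z) \<in> (adjacency (delete_vertex (edge ` C) c))\<^sup>*}"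

lemma reach_closed:
  assumes "j \<in> C" "c \<notin> edge j" "edge j \<inter> reach C c \<noteq> {}"
  shows "edge j \<subseteq> reach C c"
proof -
  have "edge j \<in> delete_vertex (edge ` C) c" using assms by (auto simp: delete_vertex_def)
  then have "(a, b) \<in> adjacency (delete_vertex (edge ` C) c)" if "{a, b} = edge j" for a b
    using that by (simp add: adjacency_def)
  then show ?thesis using assms(3) unfolding reach_def edge_def
    by (auto intro: rtrancl_into_rtrancl simp: insert_commute)
qed

lemma reach_subset:
  assumes "closed_marks C c M" "(if 0 < c then 0 else 1) \<in> M"
  shows "reach C c \<subseteq> M"
proof
  fix z assume "z \<in> reach C c"
  then have "(if 0 < c then 0 else 1, z) \<in> (adjacency (delete_vertex (edge ` C) c))\<^sup>*" by (simp add: reach_def)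
  then show "z \<in> M"
  proof (rule rtrancl_adjacency_closed)
    fix a b assume ab: "a \<in> M" "{a, b} \<in> delete_vertex (edge ` C) c"
    then obtain j where "j \<in> C" "{a, b} = edge j" "c \<notin> edge j" by (auto simp: delete_vertex_def)
    then show "b \<in> M" using assms(1) ab(1) unfolding closed_marks_def by blast
  qed (use assms(2) in simp)
qed

text \<open>A mark set during the sweep may already act on later cells, so the result depends on the
  order of the cells. Only two bounds are kept: neighbours of the initial marks are marked, and no
  mark leaves \<open>reach C c\<close>.\<close>

lemma wp_round:
  assumes s: "reg s 0 = n" "reg s 1 = n * n"
    and C: "C = present (cell s) - {reg s 12}" "c = reg s 16"
    and M: "marked (mark s) \<subseteq> reach C c"
  shows "wp (Cells 19 20 21 Relax) (\<lambda>s'. same_regs {19, 20, 21} s s' \<and> cell s' = cell s \<and> acc s' = acc s \<and>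
     marked (mark s) \<subseteq> marked (mark s') \<and> marked (mark s') \<subseteq> reach C c \<and>
     (\<forall>j\<in>C. c \<notin> edge j \<longrightarrow> edge j \<inter> marked (mark s) \<noteq> {} \<longrightarrow> edge j \<subseteq> marked (mark s'))) (cells_time n 300) s"
proof (rule wp_Cells[where I = "\<lambda>m s'. same_regs {19, 20, 21} s s' \<and> cell s' = cell s \<and> acc s' = acc s \<and>
     marked (mark s) \<subseteq> marked (mark s') \<and> marked (mark s') \<subseteq> reach C c \<and>
     (\<forall>j\<in>C. j < m \<longrightarrow> c \<notin> edge j \<longrightarrow> edge j \<inter> marked (mark s) \<noteq> {} \<longrightarrow> edge j \<subseteq> marked (mark s'))"])
  have up: "C \<subseteq> {i. upper i}" using C(1) present_upper by blast
  fix m s'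
  assume m: "m < n * n" "reg s' 19 = m" "reg s' 20 = m div n" "reg s' 21 = m mod n"
    and I: "same_regs {19, 20, 21} s s' \<and> cell s' = cell s \<and> acc s' = acc s \<and>
     marked (mark s) \<subseteq> marked (mark s') \<and> marked (mark s') \<subseteq> reach C c \<and>
     (\<forall>j\<in>C. j < m \<longrightarrow> c \<notin> edge j \<longrightarrow> edge j \<inter> marked (mark s) \<noteq> {} \<longrightarrow> edge j \<subseteq> marked (mark s'))"
  have Cc: "present (cell s') - {reg s' 12} = C" "reg s' 16 = c"
    using I C by (auto simp: same_regs_def)
  let ?r = "relax C c m (mark s')"
  have 1: "marked (mark s') \<subseteq> marked ?r" "m \<in> C \<Longrightarrow> c \<notin> edge m \<Longrightarrow> edge m \<inter> marked (mark s') \<noteq> {} \<Longrightarrow> edge m \<subseteq> marked ?r"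
    unfolding marked_relax[OF up] by auto
  have 2: "marked ?r \<subseteq> reach C c"
    unfolding marked_relax[OF up] using I reach_closed[of m C c] by auto
  have 3: "\<forall>j\<in>C. j < Suc m \<longrightarrow> c \<notin> edge j \<longrightarrow> edge j \<inter> marked (mark s) \<noteq> {} \<longrightarrow> edge j \<subseteq> marked ?r"
    using I 1 unfolding less_Suc_eq by blast
  show "wp Relax (\<lambda>s'a. (same_regs {19, 20, 21} s s'a \<and> cell s'a = cell s \<and> acc s'a = acc s \<and>
     marked (mark s) \<subseteq> marked (mark s'a) \<and> marked (mark s'a) \<subseteq> reach C c \<and>
     (\<forall>j\<in>C. j < Suc m \<longrightarrow> c \<notin> edge j \<longrightarrow> edge j \<inter> marked (mark s) \<noteq> {} \<longrightarrow> edge j \<subseteq> marked (mark s'a))) \<and>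
     reg s'a 19 = m \<and> reg s'a 20 = m div n \<and> reg s'a 21 = m mod n) 300 s'"
    by (rule wp_conseq[OF wp_Relax[OF m]]) (use I 1 2 3 m Cc in \<open>auto simp: same_regs_def\<close>)
next
  fix s' assume I: "same_regs {19, 20, 21} s s' \<and> cell s' = cell s \<and> acc s' = acc s \<and>
     marked (mark s) \<subseteq> marked (mark s') \<and> marked (mark s') \<subseteq> reach C c \<and>
     (\<forall>j\<in>C. j < n * n \<longrightarrow> c \<notin> edge j \<longrightarrow> edge j \<inter> marked (mark s) \<noteq> {} \<longrightarrow> edge j \<subseteq> marked (mark s'))"
  have "\<forall>j\<in>C. j < n * n" using C(1) by (auto simp: present_def upper_def)
  then show "same_regs {19, 20, 21} s s' \<and> cell s' = cell s \<and> acc s' = acc s \<and>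
     marked (mark s) \<subseteq> marked (mark s') \<and> marked (mark s') \<subseteq> reach C c \<and>
     (\<forall>j\<in>C. c \<notin> edge j \<longrightarrow> edge j \<inter> marked (mark s) \<noteq> {} \<longrightarrow> edge j \<subseteq> marked (mark s'))"
    using I by blast
qed (use s M in \<open>auto simp: same_regs_def\<close>)

end

context ram
begin

lemma wp_then:
  "wp p P T1 s \<Longrightarrow> (\<And>s'. P s' \<Longrightarrow> wp q Q T2 s') \<Longrightarrow> wp (Seq p q) Q (T1 + T2) s"
  by (rule wp_Seq, rule wp_conseq)

text \<open>Progress of the sweeps: closed marks already contain everything reachable and stay the
  same, while marks that are not closed strictly grow. As at most \<open>n\<close> vertices can be
  marked, \<open>n\<close> sweeps suffice.\<close>

lemma closed_or_grows:
  assumes "M0 \<subseteq> M1" "M1 \<subseteq> reach C c" "(if 0 < c then 0 else 1) \<in> M0" "finite M1"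
    and "\<forall>j\<in>C. c \<notin> edge j \<longrightarrow> edge j \<inter> M0 \<noteq> {} \<longrightarrow> edge j \<subseteq> M1"
    and "closed_marks C c M0 \<or> t < card M0"
  shows "closed_marks C c M1 \<or> Suc t < card M1"
proof (cases "M0 = M1")
  case True
  then show ?thesis using assms(5) by (simp add: closed_marks_def)
next
  case False
  then have "card M0 < card M1" using assms(1,4) by (intro psubset_card_mono) auto
  moreover have "\<not> closed_marks C c M0"
    using reach_subset[of C c M0] assms(1-3) False by blast
  ultimately show ?thesis using assms(6) by linarith
qed

text \<open>Register 15 is kept or cleared, never set, so running the test for all \<open>c\<close>
  in turn forms the conjunction of the outcomes.\<close>

lemma wp_Connected:
  assumes s: "reg s 0 = n" "reg s 1 = n * n" and c: "reg s 16 = c"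
    and C: "C = present (cell s) - {reg s 12}"
  shows "wp Connected (\<lambda>s'. same_regs {15, 17, 18, 19, 20, 21} s s' \<and> cell s' = cell s \<and> acc s' = acc s \<and>
     reg s' 15 = (if \<forall>a<n. a \<noteq> c \<longrightarrow> a \<in> reach C c then reg s 15 else 0)) (connected_time n) s"
proof -
  let ?st = "if 0 < c then 0 else 1 :: nat"
  let ?F = "\<lambda>s'. same_regs {17, 18, 19, 20, 21} s s' \<and> cell s' = cell s \<and> acc s' = acc s"
  have clear: "wp (For 18 (Reg 0) (SetMark (Reg 18) (NConst 0))) (\<lambda>s'. ?F s' \<and> (\<forall>a<n. mark s' a = 0)) (for_time n 100) s"
    by (rule wp_For[where I = "\<lambda>i s'. ?F s' \<and> (\<forall>a<i. mark s' a = 0)"];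
        (rule wp_straight, intro straight_rules)?)
      (use s in \<open>auto simp: same_regs_def less_Suc_eq\<close>)
  have start: "wp (Ite (NLess (NConst 0) (Reg 16)) (SetMark (NConst 0) (NConst 1)) (SetMark (NConst 1) (NConst 1)))
      (\<lambda>s'. ?F s' \<and> marked (mark s') = {?st}) 100 s1"
    if "?F s1 \<and> (\<forall>a<n. mark s1 a = 0)" for s1
  proof -
    have "reg s1 16 = c" using that c by (auto simp: same_regs_def)
    note r = this
    show ?thesis
      by (rule wp_straight, intro straight_rules) (use r that n2 in \<open>auto simp: marked_def same_regs_def\<close>)
  qed
  have rounds: "wp (For 17 (Reg 0) (Cells 19 20 21 Relax)) (\<lambda>s'. ?F s' \<and> marked (mark s') = reach C c \<inter> {..<n})
      (for_time n (cells_time n 300)) s2" if s2: "?F s2 \<and> marked (mark s2) = {?st}" for s2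
  proof (rule wp_For[where I = "\<lambda>t s'. ?F s' \<and> ?st \<in> marked (mark s') \<and> marked (mark s') \<subseteq> reach C c \<and>
      (closed_marks C c (marked (mark s')) \<or> t < card (marked (mark s')))"])
    show "?F s2 \<and> ?st \<in> marked (mark s2) \<and> marked (mark s2) \<subseteq> reach C c \<and>
      (closed_marks C c (marked (mark s2)) \<or> 0 < card (marked (mark s2)))"
      using s2 by (auto simp: reach_def)
  next
    fix t s'
    assume t: "?F s' \<and> ?st \<in> marked (mark s') \<and> marked (mark s') \<subseteq> reach C c \<and>
      (closed_marks C c (marked (mark s')) \<or> t < card (marked (mark s')))" "reg s' 17 = t"
    have r: "reg s' 0 = n" "reg s' 1 = n * n" "C = present (cell s') - {reg s' 12}" "c = reg s' 16"
      using t(1) s c C by (auto simp: same_regs_def)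
    have M: "marked (mark s') \<subseteq> reach C c" using t(1) by blast
    show "wp (Cells 19 20 21 Relax) (\<lambda>s''. reg s'' 17 = t \<and> ?F s'' \<and> ?st \<in> marked (mark s'') \<and>
        marked (mark s'') \<subseteq> reach C c \<and>
        (closed_marks C c (marked (mark s'')) \<or> Suc t < card (marked (mark s'')))) (cells_time n 300) s'"
    proof (rule wp_conseq[OF wp_round[OF r M]])
      fix s'' assume a: "same_regs {19, 20, 21} s' s'' \<and> cell s'' = cell s' \<and> acc s'' = acc s' \<and>
         marked (mark s') \<subseteq> marked (mark s'') \<and> marked (mark s'') \<subseteq> reach C c \<and>
         (\<forall>j\<in>C. c \<notin> edge j \<longrightarrow> edge j \<inter> marked (mark s') \<noteq> {} \<longrightarrow> edge j \<subseteq> marked (mark s''))"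
      have "finite (marked (mark s''))" by (simp add: marked_def)
      then have "closed_marks C c (marked (mark s'')) \<or> Suc t < card (marked (mark s''))"
        using closed_or_grows[of "marked (mark s')" "marked (mark s'')" C c t] a t(1) by blast
      moreover have "reg s'' 17 = t \<and> ?F s''" using a t by (auto simp: same_regs_def)
      ultimately show "reg s'' 17 = t \<and> ?F s'' \<and> ?st \<in> marked (mark s'') \<and>
        marked (mark s'') \<subseteq> reach C c \<and>
        (closed_marks C c (marked (mark s'')) \<or> Suc t < card (marked (mark s'')))" using a t(1) by blast
    qed
  next
    fix s' assume a: "?F s' \<and> ?st \<in> marked (mark s') \<and> marked (mark s') \<subseteq> reach C c \<and>
      (closed_marks C c (marked (mark s')) \<or> n < card (marked (mark s')))"
    have sub: "marked (mark s') \<subseteq> {..<n}" by (auto simp: marked_def)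
    then have "card (marked (mark s')) \<le> n" using card_mono[OF _ sub] by simp
    then have "reach C c \<subseteq> marked (mark s')" using a reach_subset[of C c "marked (mark s')"] by auto
    then show "?F s' \<and> marked (mark s') = reach C c \<inter> {..<n}" using a sub by blast
  qed (use s in \<open>auto simp: same_regs_def\<close>)
  have check: "wp (For 18 (Reg 0) (Ite (BAnd (BNeq (Reg 18) (Reg 16)) (NLess (Mark (Reg 18)) (NConst 1)))
          (SetReg 15 (NConst 0)) Skip)) (\<lambda>s'. same_regs {15, 17, 18, 19, 20, 21} s s' \<and> cell s' = cell s \<and> acc s' = acc s \<and>
     reg s' 15 = (if \<forall>a<n. a \<noteq> c \<longrightarrow> a \<in> reach C c then reg s 15 else 0)) (for_time n 100) s3"
    if s3: "?F s3 \<and> marked (mark s3) = reach C c \<inter> {..<n}" for s3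
  proof -
    have eq: "a \<in> reach C c \<longleftrightarrow> 0 < mark s3 a" if "a < n" for a
      using s3 that by (auto simp: marked_def)
    show ?thesis
      by (rule wp_For[where I = "\<lambda>i s'. same_regs {15, 17, 18, 19, 20, 21} s s' \<and> cell s' = cell s \<and> acc s' = acc s \<and>
         mark s' = mark s3 \<and> reg s' 15 = (if \<forall>a<i. a \<noteq> c \<longrightarrow> 0 < mark s3 a then reg s 15 else 0)"];
          (rule wp_straight, intro straight_rules)?)
        (use s s3 eq c in \<open>auto simp: same_regs_def less_Suc_eq\<close>)
  qed
  show ?thesis unfolding Connected_def connected_time_def
    by (rule wp_then[OF clear], rule wp_then[OF start], assumption, rule wp_then[OF rounds], assumption, rule check)
qed

lemma wp_Biconnected:
  assumes s: "reg s 0 = n" "reg s 1 = n * n"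
  shows "wp Biconnected (\<lambda>s'. same_regs {15..21} s s' \<and> cell s' = cell s \<and> acc s' = acc s \<and>
     reg s' 15 = (if biconnected {..<n} (edge ` (present (cell s) - {reg s 12})) then 1 else 0)) (biconnected_time n) s"
proof -
  define C where "C = present (cell s) - {reg s 12}"
  have up: "C \<subseteq> {i. upper i}" using present_upper by (auto simp: C_def)
  have iff: "biconnected {..<n} (edge ` C) \<longleftrightarrow> (\<forall>c<n + 1. \<forall>a<n. a \<noteq> c \<longrightarrow> a \<in> reach C c)"
    unfolding biconnected_iff_reachable[OF simple_graph_edges[OF up] n2] reach_def by (auto simp: less_Suc_eq_le)
  let ?I = "\<lambda>i s'. same_regs {15..21} s s' \<and> cell s' = cell s \<and> acc s' = acc s \<and>
     reg s' 15 = (if \<forall>c<i. \<forall>a<n. a \<noteq> c \<longrightarrow> a \<in> reach C c then 1 else 0)"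
  have "wp (For 16 (NAdd (Reg 0) (NConst 1)) Connected) (?I (n + 1)) (for_time (n + 1) (connected_time n)) (upd s 15 1)"
  proof (rule wp_For[where I = ?I])
    fix i s' assume i: "?I i s'" "reg s' 16 = i"
    have r: "reg s' 0 = n" "reg s' 1 = n * n" "C = present (cell s') - {reg s' 12}"
      using i s by (auto simp: same_regs_def C_def)
    show "wp Connected (\<lambda>s''. reg s'' 16 = i \<and> ?I (Suc i) s'') (connected_time n) s'"
      by (rule wp_conseq[OF wp_Connected[OF r(1,2) i(2) r(3)]]) (use i in \<open>auto simp: same_regs_def less_Suc_eq\<close>)
  qed (use s in \<open>auto simp: same_regs_def\<close>)
  note loop = this
  show ?thesis unfolding Biconnected_def biconnected_time_def C_def[symmetric] iff
    by (rule wp_straight_Seq[where T = "for_time (n + 1) (connected_time n)"], rule straight_rules(4))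
      (use loop in auto)
qed

end

section \<open>Choosing, deleting and decoding branches on the machine\<close>

definition Pick :: com where
  "Pick = Seq (SetReg 11 (Reg 1)) (Cells 12 13 14
     (Ite (BAnd (NLess (Reg 13) (Reg 14)) (BAnd (NLess (NConst 0) (Cell (Reg 12))) (NLess (Cell (Reg 12)) (NConst 2))))
       (Seq Biconnected
         (Ite (BAnd (NLess (NConst 0) (Reg 15))
             (BNot (BAnd (NLess (Reg 11) (Reg 1)) (BNot (RLess (Weight (Reg 11)) (Weight (Reg 12)))))))
           (SetReg 11 (Reg 12)) Skip)) Skip))"

definition MarkBest :: com where
  "MarkBest = Seq Pick (Ite (NLess (Reg 11) (Reg 1)) (SetCell (Reg 11) (NConst 2)) Skip)"

definition DeleteBest :: com where
  "DeleteBest = Seq Pick (Ite (NLess (Reg 11) (Reg 1))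
     (Seq (SetCell (Reg 11) (NConst 3)) (SetAcc (RAdd Acc (Weight (Reg 11))))) Skip)"

definition Reset :: com where
  "Reset = Cells 12 13 14 (Ite (NLess (NConst 0) (Cell (Reg 12))) (SetCell (Reg 12) (NConst 1)) Skip)"

definition DivMod :: com where
  "DivMod = Seq (SetReg 8 (NConst 0)) (Seq (SetReg 23 (Reg 7)) (For 22 (Reg 23)
     (Ite (NLess (Reg 7) (Reg 3)) Skip
       (Seq (SetReg 7 (NSub (Reg 7) (Reg 3))) (SetReg 8 (NAdd (Reg 8) (NConst 1)))))))"

definition Digit :: com where
  "Digit = Seq DivMod (Seq (For 10 (Reg 7) MarkBest) (Seq DeleteBest (SetReg 7 (Reg 8))))"

definition Run :: com where
  "Run = Seq Reset (Seq (Seq (SetAcc RZero) (SetReg 7 (Reg 5))) (For 9 (Reg 2) Digit))"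

definition Search :: com where
  "Search = Seq (SetReg 6 (NConst 0)) (For 5 (Reg 4)
     (Seq Run (Ite (RLess Acc (RLoad (NConst 0))) Skip (SetReg 6 (NConst 1)))))"

definition pick_time :: "nat \<Rightarrow> nat" where
  "pick_time n = 20 + cells_time n (biconnected_time n + 200)"

definition digit_time :: "nat \<Rightarrow> nat \<Rightarrow> nat \<Rightarrow> nat" where
  "digit_time n N m = (for_time m 100 + 30) + (for_time N (pick_time n + 100) + ((pick_time n + 100) + 100))"

definition run_time :: "nat \<Rightarrow> nat \<Rightarrow> nat \<Rightarrow> nat \<Rightarrow> nat" where
  "run_time n k N m = cells_time n 100 + (100 + for_time k (digit_time n N m))"

definition search_time :: "nat \<Rightarrow> nat \<Rightarrow> nat \<Rightarrow> nat \<Rightarrow> nat" where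
  "search_time n k N m = 6 + for_time m (run_time n k N m + 100)"

lemma for_time_mono: "m \<le> m' \<Longrightarrow> T \<le> T' \<Longrightarrow> for_time m T \<le> for_time m' T'"
  unfolding for_time_def by (intro add_mono mult_le_mono) auto

context ram
begin

lemma wp_Pick:
  assumes s: "reg s 0 = n" "reg s 1 = n * n"
  shows "wp Pick (\<lambda>s'. same_regs {11..21} s s' \<and> cell s' = cell s \<and> acc s' = acc s \<and>
     reg s' 11 = best (cell s) (n * n)) (pick_time n) s"
proof -
  let ?I = "\<lambda>m s'. same_regs {11..21} s s' \<and> cell s' = cell s \<and> acc s' = acc s \<and> reg s' 11 = best (cell s) m"
  let ?inner = "Ite (BAnd (NLess (NConst 0) (Reg 15))
             (BNot (BAnd (NLess (Reg 11) (Reg 1)) (BNot (RLess (Weight (Reg 11)) (Weight (Reg 12)))))))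
           (SetReg 11 (Reg 12)) Skip"
  let ?body = "Ite (BAnd (NLess (Reg 13) (Reg 14)) (BAnd (NLess (NConst 0) (Cell (Reg 12))) (NLess (Cell (Reg 12)) (NConst 2))))
       (Seq Biconnected ?inner) Skip"
  have "wp (Cells 12 13 14 ?body) (?I (n * n)) (cells_time n (biconnected_time n + 200)) (upd s 11 (n * n))"
  proof (rule wp_Cells[where I = ?I])
    fix m s'
    assume m: "m < n * n" and I: "?I m s'" and r: "reg s' 12 = m" "reg s' 13 = m div n" "reg s' 14 = m mod n"
    let ?Q = "\<lambda>s'. ?I (Suc m) s' \<and> reg s' 12 = m \<and> reg s' 13 = m div n \<and> reg s' 14 = m mod n"
    have s': "reg s' 0 = n" "reg s' 1 = n * n" using I s by (auto simp: same_regs_def)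
    let ?b = "biconnected {..<n} (edge ` (present (cell s) - {m}))"
    have cm: "nval (Cell (Reg 12)) (mem s') = cell s m" using r m I by (simp add: nval_Cell)
    have "wp (Seq Biconnected ?inner) ?Q (biconnected_time n + 60) s'" if um: "upper m" "cell s m = 1"
    proof (rule wp_then[OF wp_Biconnected[OF s']])
      fix s''
      assume a: "same_regs {15..21} s' s'' \<and> cell s'' = cell s' \<and> acc s'' = acc s' \<and>
        reg s'' 15 = (if biconnected {..<n} (edge ` (present (cell s') - {reg s' 12})) then 1 else 0)"
      have keep: "reg s'' 12 = m" "reg s'' 13 = m div n" "reg s'' 14 = m mod n" "reg s'' 0 = n" "reg s'' 1 = n * n"
        "reg s'' 11 = best (cell s) m" "reg s'' 15 = (if ?b then 1 else 0)" "cell s'' = cell s" "acc s'' = acc s"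
        "same_regs {11..21} s s''"
        using a I r s' by (auto simp: same_regs_def)
      have d: "deletable (cell s) m \<longleftrightarrow> ?b" using um by (simp add: deletable_def)
      \<comment> \<open>If \<open>best\<close> is \<open>n * n\<close>, the weight read in register
        11 lies outside the matrix; the first conjunct is then false whatever the comparison gives.
        Hence the case distinction.\<close>
      have guard: "bval (BAnd (NLess (NConst 0) (Reg 15))
             (BNot (BAnd (NLess (Reg 11) (Reg 1)) (BNot (RLess (Weight (Reg 11)) (Weight (Reg 12))))))) (mem s'') \<longleftrightarrow>
          ?b \<and> (\<not> best (cell s) m < n * n \<or> wt (best (cell s) m) < wt m)"
        using keep m by (cases "best (cell s) m < n * n") (auto simp: rval_Weight)
      show "wp ?inner ?Q 60 s''"
      proof (rule wp_straight, intro straight_rules, unfold guard)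
        assume "?b \<and> (\<not> best (cell s) m < n * n \<or> wt (best (cell s) m) < wt m)"
        then show "?Q (upd s'' 11 (nval (Reg 12) (mem s'')))" using keep d by (auto simp: same_regs_def)
      next
        assume "\<not> (?b \<and> (\<not> best (cell s) m < n * n \<or> wt (best (cell s) m) < wt m))"
        then show "?Q s''" using keep d by (auto simp: same_regs_def)
      qed auto
    qed
    moreover have "?Q s'" if "\<not> (upper m \<and> cell s m = 1)"
      using that I r by (auto simp: deletable_def)
    moreover have "bval (BAnd (NLess (Reg 13) (Reg 14)) (BAnd (NLess (NConst 0) (Cell (Reg 12))) (NLess (Cell (Reg 12)) (NConst 2)))) (mem s')
      \<longleftrightarrow> upper m \<and> cell s m = 1"
      using r cm m by (auto simp: upper_def)
    ultimately have "wp ?body ?Q (1 + bcost (BAnd (NLess (Reg 13) (Reg 14)) (BAnd (NLess (NConst 0) (Cell (Reg 12))) (NLess (Cell (Reg 12)) (NConst 2))))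
       + (biconnected_time n + 60) + 1) s'"
      by (intro wp_Ite wp_Skip) auto
    then show "wp ?body ?Q (biconnected_time n + 200) s'" by (rule wp_weaken) simp
  qed (use s in \<open>auto simp: same_regs_def\<close>)
  note loop = this
  have nv: "nval (Reg 1) (mem s) = n * n" using s by simp
  show ?thesis unfolding Pick_def pick_time_def
    by (rule wp_straight_Seq[where T = "cells_time n (biconnected_time n + 200)"], rule straight_rules(4), simp,
      unfold nv, rule loop) simp
qed

lemma wp_MarkBest:
  assumes s: "reg s 0 = n" "reg s 1 = n * n"
  shows "wp MarkBest (\<lambda>s'. same_regs {11..21} s s' \<and> cell s' = step 2 (cell s) \<and> acc s' = acc s) (pick_time n + 100) s"
  unfolding MarkBest_def
  by (rule wp_then[OF wp_Pick[OF s]], rule wp_straight, intro straight_rules)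
    (use s in \<open>auto simp: same_regs_def step_def\<close>)

lemma wp_DeleteBest:
  assumes s: "reg s 0 = n" "reg s 1 = n * n" and a: "acc s = sum wt (deleted (cell s))"
  shows "wp DeleteBest (\<lambda>s'. same_regs {11..21} s s' \<and> cell s' = step 3 (cell s) \<and>
     acc s' = sum wt (deleted (cell s'))) (pick_time n + 100) s"
  unfolding DeleteBest_def
proof (rule wp_then[OF wp_Pick[OF s]])
  fix s' assume s': "same_regs {11..21} s s' \<and> cell s' = cell s \<and> acc s' = acc s \<and> reg s' 11 = best (cell s) (n * n)"
  let ?b = "best (cell s) (n * n)"
  have r: "reg s' 1 = n * n" using s s' by (auto simp: same_regs_def)
  show "wp (Ite (NLess (Reg 11) (Reg 1)) (Seq (SetCell (Reg 11) (NConst 3)) (SetAcc (RAdd Acc (Weight (Reg 11))))) Skip)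
     (\<lambda>s'. same_regs {11..21} s s' \<and> cell s' = step 3 (cell s) \<and> acc s' = sum wt (deleted (cell s'))) 100 s'"
  proof (rule wp_straight, intro straight_rules)
    assume "bval (NLess (Reg 11) (Reg 1)) (mem s')"
    then have b: "?b < n * n" using s' r by simp
    then show "nval (Reg 11) (mem s') < n * n" using s' by simp
    have "deletable (cell s) ?b" using best_deletable[OF b] by blast
    then have d: "deleted ((cell s)(?b := 3)) = insert ?b (deleted (cell s))" "?b \<notin> deleted (cell s)"
      using present_delete[of "cell s" ?b] by (auto simp: deletable_def)
    let ?s = "s'\<lparr>cell := (cell s')(nval (Reg 11) (mem s') := nval (NConst 3) (mem s'))\<rparr>"
    have "rval (Weight (Reg 11)) (mem ?s) = wt ?b" using s' b by (simp add: rval_Weight)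
    then show "same_regs {11..21} s (?s\<lparr>acc := rval (RAdd Acc (Weight (Reg 11))) (mem ?s)\<rparr>) \<and>
      cell (?s\<lparr>acc := rval (RAdd Acc (Weight (Reg 11))) (mem ?s)\<rparr>) = step 3 (cell s) \<and>
      acc (?s\<lparr>acc := rval (RAdd Acc (Weight (Reg 11))) (mem ?s)\<rparr>) =
        sum wt (deleted (cell (?s\<lparr>acc := rval (RAdd Acc (Weight (Reg 11))) (mem ?s)\<rparr>)))"
      using s' b d a finite_deleted[of "cell s"] by (auto simp: same_regs_def step_def)
  next
    assume "\<not> bval (NLess (Reg 11) (Reg 1)) (mem s')"
    then have "\<not> ?b < n * n" using s' r by simp
    then show "same_regs {11..21} s s' \<and> cell s' = step 3 (cell s) \<and> acc s' = sum wt (deleted (cell s'))"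
      using s' a by (auto simp: step_def)
  qed simp
qed

text \<open>Undoes a branch: steps turn nonzero states into nonzero states only, so the initial
  graph can be recovered from any later state. The nonzero scratch cells on the diagonal become 1 as
  well, which \<open>upper\<close> ignores.\<close>

definition reset :: "(nat \<Rightarrow> nat) \<Rightarrow> nat \<Rightarrow> nat" where
  "reset g i = (if i < n * n \<and> 0 < g i then 1 else g i)"

lemma reset_step: "0 < s \<Longrightarrow> reset (step s g) = reset g"
  by (rule step_spec[of s g]) (auto simp: reset_def fun_eq_iff deletable_def)

lemma reset_marks: "reset ((step 2 ^^ a) g) = reset g"
  by (induction a) (simp_all add: reset_step)

lemma reset_search: "reset (search l t g) = reset g"
  by (induction l arbitrary: t g) (simp_all add: reset_step reset_marks)

lemma deleted_reset: "deleted (reset g) = {}"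
  by (auto simp: deleted_def reset_def upper_def)

lemma wp_Reset:
  assumes s: "reg s 0 = n" "reg s 1 = n * n"
  shows "wp Reset (\<lambda>s'. same_regs {12..14} s s' \<and> cell s' = reset (cell s)) (cells_time n 100) s"
  unfolding Reset_def
proof (rule wp_Cells[where I = "\<lambda>m s'. same_regs {12..14} s s' \<and> cell s' = (\<lambda>i. if i < m then reset (cell s) i else cell s i)"])
  fix m s' assume m: "m < n * n" and r: "reg s' 12 = m" "reg s' 13 = m div n" "reg s' 14 = m mod n"
    and I: "same_regs {12..14} s s' \<and> cell s' = (\<lambda>i. if i < m then reset (cell s) i else cell s i)"
  have "nval (Cell (Reg 12)) (mem s') = cell s m" using r m I by (simp add: nval_Cell)
  note r' = this
  show "wp (Ite (NLess (NConst 0) (Cell (Reg 12))) (SetCell (Reg 12) (NConst 1)) Skip)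
     (\<lambda>s'. (same_regs {12..14} s s' \<and> cell s' = (\<lambda>i. if i < Suc m then reset (cell s) i else cell s i)) \<and>
       reg s' 12 = m \<and> reg s' 13 = m div n \<and> reg s' 14 = m mod n) 100 s'"
    by (rule wp_straight, intro straight_rules)
      (use r r' m I in \<open>auto simp: same_regs_def reset_def fun_eq_iff less_Suc_eq\<close>)
qed (use s in \<open>auto simp: same_regs_def reset_def fun_eq_iff\<close>)

text \<open>Division by repeated subtraction. The loop runs \<open>t\<close> times, a bound that is
  available without knowing the quotient; this is where the second factor \<open>N ^ k\<close> of
  the running time comes from.\<close>

lemma wp_DivMod:
  assumes s: "reg s 3 = N" "0 < N" "reg s 7 = t"
  shows "wp DivMod (\<lambda>s'. same_regs {7, 8, 22, 23} s s' \<and> cell s' = cell s \<and> acc s' = acc s \<and>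
     reg s' 7 = t mod N \<and> reg s' 8 = t div N) (for_time t 100 + 30) s"
proof -
  let ?I = "\<lambda>i s'. same_regs {7, 8, 22, 23} s s' \<and> cell s' = cell s \<and> acc s' = acc s \<and> reg s' 23 = t \<and>
     t = reg s' 7 + N * reg s' 8 \<and> (reg s' 7 < N \<or> i \<le> reg s' 8)"
  let ?p = "For 22 (Reg 23) (Ite (NLess (Reg 7) (Reg 3)) Skip
       (Seq (SetReg 7 (NSub (Reg 7) (Reg 3))) (SetReg 8 (NAdd (Reg 8) (NConst 1)))))"
  let ?Q = "\<lambda>s'. same_regs {7, 8, 22, 23} s s' \<and> cell s' = cell s \<and> acc s' = acc s \<and>
     reg s' 7 = t mod N \<and> reg s' 8 = t div N"
  have "wp ?p ?Q (for_time t 100) (upd (upd s 8 0) 23 t)"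
  proof (rule wp_For[where I = ?I])
    fix i s' assume i: "?I i s'" "reg s' 22 = i"
    have N: "reg s' 3 = N" using i s by (auto simp: same_regs_def)
    show "wp (Ite (NLess (Reg 7) (Reg 3)) Skip
       (Seq (SetReg 7 (NSub (Reg 7) (Reg 3))) (SetReg 8 (NAdd (Reg 8) (NConst 1)))))
       (\<lambda>s'. reg s' 22 = i \<and> ?I (Suc i) s') 100 s'"
      by (rule wp_straight, intro straight_rules) (use i N in \<open>auto simp: same_regs_def\<close>)
  next
    fix s' assume I: "?I t s'"
    have "reg s' 7 < N"
    proof (rule ccontr)
      \<comment> \<open>Otherwise all \<open>t\<close> rounds subtracted \<open>N\<close>, and
        \<open>t = reg s' 7 + N * reg s' 8\<close> would be at least \<open>N + t\<close>.\<close>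
      assume n: "\<not> reg s' 7 < N"
      then have "t \<le> reg s' 8" using I by blast
      moreover have "reg s' 8 \<le> N * reg s' 8" using s(2) by simp
      ultimately show False using I n s(2) by linarith
    qed
    then have "t mod N = reg s' 7" "t div N = reg s' 8" using I
      by (metis mod_mult_self2 mod_less, metis I add.commute div_mult_self4 div_less add.right_neutral s(2) not_gr_zero)
    then show "?Q s'" using I by auto
  qed (use s in \<open>auto simp: same_regs_def\<close>)
  note loop = this
  have "wp (Seq (SetReg 23 (Reg 7)) ?p) ?Q (for_time t 100 + 15) (upd s 8 0)"
    by (rule wp_straight_Seq[where T = "for_time t 100"], rule straight_rules(4)) (use loop s in auto)
  note loop' = this
  show ?thesis unfolding DivMod_def
    by (rule wp_straight_Seq[where T = "for_time t 100 + 15"], rule straight_rules(4)) (use loop' in auto)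
qed

lemma wp_Digit:
  assumes s: "reg s 0 = n" "reg s 1 = n * n" "reg s 3 = N" "0 < N" "reg s 7 = t" "t \<le> m"
    and a: "acc s = sum wt (deleted (cell s))"
  shows "wp Digit (\<lambda>s'. same_regs ({7, 8} \<union> {10..23}) s s' \<and> cell s' = step 3 ((step 2 ^^ (t mod N)) (cell s)) \<and>
     acc s' = sum wt (deleted (cell s')) \<and> reg s' 7 = t div N) (digit_time n N m) s"
proof -
  let ?S = "same_regs ({7, 8} \<union> {10..23}) s"
  have 1: "wp DivMod (\<lambda>s'. ?S s' \<and> cell s' = cell s \<and> acc s' = acc s \<and> reg s' 7 = t mod N \<and> reg s' 8 = t div N)
     (for_time m 100 + 30) s"
    by (rule wp_weaken[OF wp_conseq[OF wp_DivMod[OF s(3,4,5)]]])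
      (use s for_time_mono[OF s(6), of 100 100] in \<open>auto simp: same_regs_def\<close>)
  let ?I = "\<lambda>i s'. ?S s' \<and> cell s' = (step 2 ^^ i) (cell s) \<and> acc s' = acc s \<and> reg s' 7 = t mod N \<and> reg s' 8 = t div N"
  have 2: "wp (For 10 (Reg 7) MarkBest) (?I (t mod N)) (for_time N (pick_time n + 100)) s1"
    if s1: "?S s1 \<and> cell s1 = cell s \<and> acc s1 = acc s \<and> reg s1 7 = t mod N \<and> reg s1 8 = t div N" for s1
  proof (rule wp_weaken[OF wp_For[where I = ?I and m = "t mod N"]])
    fix i s' assume i: "?I i s'" "reg s' 10 = i"
    have r: "reg s' 0 = n" "reg s' 1 = n * n" using i s by (auto simp: same_regs_def)
    show "wp MarkBest (\<lambda>s'. reg s' 10 = i \<and> ?I (Suc i) s') (pick_time n + 100) s'"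
      by (rule wp_conseq[OF wp_MarkBest[OF r]]) (use i in \<open>auto simp: same_regs_def\<close>)
  next
    show "for_time (t mod N) (pick_time n + 100) \<le> for_time N (pick_time n + 100)"
      using s(4) by (intro for_time_mono) auto
  qed (use s1 in \<open>auto simp: same_regs_def\<close>)
  have del: "deleted ((step 2 ^^ i) (cell s)) = deleted (cell s)" for i
    by (induction i) (auto intro: step_spec[of 2] simp: present_mark deletable_def step_def dest: best_deletable(1))
  have 3: "wp DeleteBest (\<lambda>s'. ?S s' \<and> cell s' = step 3 ((step 2 ^^ (t mod N)) (cell s)) \<and>
      acc s' = sum wt (deleted (cell s')) \<and> reg s' 8 = t div N) (pick_time n + 100) s2"
    if s2: "?I (t mod N) s2" for s2
  proof -
    have r: "reg s2 0 = n" "reg s2 1 = n * n" using s2 s by (auto simp: same_regs_def)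
    have "acc s2 = sum wt (deleted (cell s2))" using s2 a del by simp
    from wp_DeleteBest[OF r this] show ?thesis
      by (rule wp_conseq) (use s2 in \<open>auto simp: same_regs_def\<close>)
  qed
  have 4: "wp (SetReg 7 (Reg 8)) (\<lambda>s'. ?S s' \<and> cell s' = step 3 ((step 2 ^^ (t mod N)) (cell s)) \<and>
     acc s' = sum wt (deleted (cell s')) \<and> reg s' 7 = t div N) 100 s3"
    if "?S s3 \<and> cell s3 = step 3 ((step 2 ^^ (t mod N)) (cell s)) \<and>
      acc s3 = sum wt (deleted (cell s3)) \<and> reg s3 8 = t div N" for s3
    by (rule wp_straight, intro straight_rules) (use that in \<open>auto simp: same_regs_def\<close>)
  show ?thesis unfolding Digit_def digit_time_def
    by (rule wp_then[OF 1], rule wp_then[OF 2], assumption, rule wp_then[OF 3], assumption, rule 4)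
qed

end

text \<open>Without multiplication, \<open>k * k\<close> and, in \<open>Power\<close>, each
  multiplication by \<open>N\<close> are loops of additions.\<close>

definition Params :: com where
  "Params = Seq (SetReg 3 (NConst 0)) (Seq (For 9 (Reg 2) (SetReg 3 (NAdd (Reg 3) (Reg 2))))
     (Seq (SetReg 3 (NAdd (NAdd (NAdd (Reg 3) (Reg 3)) (NAdd (Reg 3) (Reg 3))) (NConst 1))) (SetReg 4 (NConst 1))))"

definition Power :: com where
  "Power = For 9 (Reg 2) (Seq (SetReg 22 (NConst 0))
     (Seq (For 10 (Reg 3) (SetReg 22 (NAdd (Reg 22) (Reg 4)))) (SetReg 4 (Reg 22))))"

definition Main_loop :: com where
  "Main_loop = Seq Params (Seq Power Search)"

definition main_time :: "nat \<Rightarrow> nat \<Rightarrow> nat \<Rightarrow> nat" where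
  "main_time n k N = (for_time k 100 + 200) + (for_time k (for_time N 100 + 200) + search_time n k N (N ^ k))"

text \<open>
  The input occupies all cells with a fixed address except 0 and 1. The cells 2 and \<open>n + 3\<close> of the
  diagonal of the matrix are 0 and never inspected later, so they can serve as scratch space while
  \<open>n * n\<close> is computed.
\<close>

definition Frame :: com where
  "Frame = Seq
     (While (NLess (NLoad (NConst 2)) (NLoad (NConst 0)))
       (Seq (NStore (NAdd (NLoad (NConst 0)) (NConst 3))
              (NAdd (NLoad (NAdd (NLoad (NConst 0)) (NConst 3))) (NLoad (NConst 0))))
            (NStore (NConst 2) (NAdd (NLoad (NConst 2)) (NConst 1)))))
     (Seq (NStore (NAdd (NLoad (NAdd (NLoad (NConst 0)) (NConst 3))) (NConst 2)) (NLoad (NConst 0)))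
     (Seq (NStore (NAdd (NLoad (NAdd (NLoad (NConst 0)) (NConst 3))) (NConst 3))
              (NLoad (NAdd (NLoad (NConst 0)) (NConst 3))))
     (Seq (NStore (NAdd (NLoad (NAdd (NLoad (NConst 0)) (NConst 3))) (NConst 4)) (NLoad (NConst 1)))
       (NStore (NConst 0) (NAdd (NLoad (NAdd (NLoad (NConst 0)) (NConst 3))) (NConst 2))))))"

definition Program :: com where
  "Program = Seq Frame (Seq Main_loop (NStore (NConst 0) (Reg 6)))"

section \<open>The search decides the deletion problem\<close>

context cell_search
begin

lemma edge_surj:
  assumes "simple_graph {..<n} E" "e \<in> E"
  obtains i where "upper i" "edge i = e"
proof -
  have "card e = 2" "e \<subseteq> {..<n}" using assms unfolding simple_graph_def by blast+
  then obtain u v where uv: "e = {u, v}" "u \<noteq> v" "u < n" "v < n" unfolding card_2_iff by auto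
  define a b where "a = min u v" and "b = max u v"
  have ab: "e = {a, b}" "a < b" "b < n" using uv by (auto simp: a_def b_def min_def max_def)
  have "a * n + b < Suc a * n" using ab by simp
  also have "\<dots> \<le> n * n" using ab by (intro mult_le_mono1) simp
  finally have "a * n + b < n * n" .
  moreover have "(a * n + b) div n = a" "(a * n + b) mod n = b" using ab by simp_all
  ultimately show ?thesis using ab by (intro that[of "a * n + b"]) (auto simp: upper_def edge_def)
qed

text \<open>Left to right, a solution makes the initial states feasible, and feasibility with budget
  0 leaves no set \<open>C\<close> to account for, so the deleted cells alone reach the threshold.
  Right to left, \<open>sound\<close> turns the deleted cells of any branch into a solution.\<close>

lemma yes_iff_search:
  assumes sg: "simple_graph {..<n} E" and bi: "biconnected {..<n} E" and N: "4 * k\<^sup>2 < N"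
    and w: "\<And>i. upper i \<Longrightarrow> edge i \<in> E \<Longrightarrow> wt i = w (edge i)" "\<And>e. e \<in> E \<Longrightarrow> 0 \<le> w e"
    and h: "\<And>i. upper i \<Longrightarrow> h i = (if edge i \<in> E then 1 else 0)"
  shows "wbd_yes n E k ws w \<longleftrightarrow> (\<exists>t<N ^ k. ws \<le> sum wt (deleted (search k t h)))"
proof -
  have inj: "inj_on edge (present h)" using inj_on_edge present_upper inj_on_subset by blast
  have E: "edge ` present h = E"
  proof
    show "edge ` present h \<subseteq> E" using h by (auto simp: present_def split: if_splits)
    show "E \<subseteq> edge ` present h"
    proof
      fix e assume e: "e \<in> E"
      obtain i where "upper i" "edge i = e" by (rule edge_surj[OF sg e])
      then show "e \<in> edge ` present h" using h e by (auto simp: present_def)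
    qed
  qed
  have D0: "deleted h = {}" using h by (auto simp: deleted_def split: if_splits)
  show ?thesis
  proof
    assume "wbd_yes n E k ws w"
    then obtain S where S: "S \<subseteq> E" "card S \<le> k" "biconnected {..<n} (E - S)" "ws \<le> sum w S"
      unfolding wbd_yes_def by blast
    define C where "C = {i \<in> present h. edge i \<in> S}"
    have CS: "edge ` C = S" using S(1) E by (auto simp: C_def)
    have injC: "inj_on edge C" using inj by (rule inj_on_subset) (auto simp: C_def)
    have "edge ` (present h - C) = E - S" using E by (auto simp: C_def)
    then have f1: "biconnected {..<n} (edge ` (present h - C))" using S(3) by (rule ssubst)
    have f2: "card C \<le> k" using card_image[OF injC] CS S(2) by simp
    have "sum wt C = sum w S"
    proof -
      have "sum w (edge ` C) = sum (w \<circ> edge) C" by (rule sum.reindex[OF injC])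
      also have "\<dots> = sum wt C" using w(1) S(1) by (intro sum.cong) (auto simp: C_def present_def)
      finally show ?thesis using CS by simp
    qed
    then have f3: "ws \<le> sum wt (deleted h) + sum wt C" using S(4) D0 by simp
    have f4: "C \<subseteq> {i. upper i \<and> h i = 1}" using h by (auto simp: C_def present_def split: if_splits)
    have feas: "feasible ws k h" unfolding feasible_def
      by (intro exI[of _ C] conjI) (fact f4, fact f2, fact f1, fact f3)
    have nonneg: "0 \<le> wt i" if "upper i" "h i = 1" for i
    proof -
      have "edge i \<in> E"
      proof (rule ccontr)
        assume "edge i \<notin> E"
        then have "h i = 0" using h[OF that(1)] by (simp only: if_False)
        then show False using that(2) by (simp only: zero_neq_one)
      qed
      then show ?thesis using w(1)[OF that(1)] w(2)[of "edge i"] by (simp only:)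
    qed
    obtain t where t: "t < N ^ k" "feasible ws 0 (search k t h)"
      using feasible_search[OF feas N nonneg] by blast
    from t(2) obtain C0 where C0: "C0 \<subseteq> {i. upper i \<and> search k t h i = 1}" "card C0 = 0"
      "ws \<le> sum wt (deleted (search k t h)) + sum wt C0"
      unfolding feasible_def by auto
    have "C0 = {}" using C0(2) finite_upper_subset[OF C0(1)] by simp
    then have "ws \<le> sum wt (deleted (search k t h))" using C0(3) by simp
    then show "\<exists>t<N ^ k. ws \<le> sum wt (deleted (search k t h))" using t(1) by blast
  next
    assume "\<exists>t<N ^ k. ws \<le> sum wt (deleted (search k t h))"
    then obtain t where t: "ws \<le> sum wt (deleted (search k t h))" by blast
    let ?g = "search k t h"
    have "sound 0 h h" using bi E D0 h by (auto simp: sound_def)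
    from sound_search[OF this, of k t] have s: "sound k h ?g" by simp
    have injU: "inj_on edge (deleted ?g)" by (rule inj_on_subset[OF inj_on_edge]) (auto simp: deleted_def)
    have status: "upper i \<Longrightarrow> ?g i \<in> {1, 2, 3} \<longleftrightarrow> h i = 1" for i using s by (simp add: sound_def)
    have "h i \<noteq> 2" if "upper i" for i using h[OF that] by (cases "edge i \<in> E") auto
    then have "present h = {i. upper i \<and> h i = 1}" by (auto simp: present_def)
    also have "\<dots> = {i. upper i \<and> ?g i \<in> {1, 2, 3}}" using status by blast
    also have "\<dots> = present ?g \<union> deleted ?g" by (auto simp: present_def deleted_def)
    finally have un: "present h = present ?g \<union> deleted ?g" .
    have disj: "present ?g \<inter> deleted ?g = {}" by (auto simp: present_def deleted_def)
    have "edge ` present ?g = E - edge ` deleted ?g"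
    proof -
      have "edge ` (present h - deleted ?g) = edge ` present h - edge ` deleted ?g"
        by (rule inj_on_image_set_diff[OF inj]) (use un in auto)
      moreover have "present h - deleted ?g = present ?g" using un disj by blast
      ultimately show ?thesis using E by simp
    qed
    moreover have "edge ` deleted ?g \<subseteq> E" using E un by blast
    moreover have "card (edge ` deleted ?g) \<le> k" using s card_image[OF injU] by (simp add: sound_def)
    moreover have "sum w (edge ` deleted ?g) = sum wt (deleted ?g)"
    proof -
      have "sum w (edge ` deleted ?g) = sum (w \<circ> edge) (deleted ?g)" by (rule sum.reindex[OF injU])
      also have "\<dots> = sum wt (deleted ?g)"
        using w(1) E un by (intro sum.cong) (auto simp: deleted_def)
      finally show ?thesis .
    qed
    ultimately show "wbd_yes n E k ws w"
      using s t unfolding wbd_yes_def sound_def by (intro exI[of _ "edge ` deleted ?g"]) simp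
  qed
qed

end

context ram
begin

lemma wp_Run:
  assumes s: "reg s 0 = n" "reg s 1 = n * n" "reg s 2 = k" "reg s 3 = N" "0 < N" "reg s 5 = t" "t \<le> m"
  shows "wp Run (\<lambda>s'. same_regs {7..23} s s' \<and> cell s' = search k t (reset (cell s)) \<and>
     acc s' = sum wt (deleted (cell s'))) (run_time n k N m) s"
proof -
  have 2: "wp (Seq (SetAcc RZero) (SetReg 7 (Reg 5))) (\<lambda>s'. same_regs {7..23} s s' \<and> cell s' = reset (cell s) \<and>
     acc s' = 0 \<and> reg s' 7 = t) 100 s1" if "same_regs {12..14} s s1 \<and> cell s1 = reset (cell s)" for s1
    by (rule wp_straight, intro straight_rules) (use that s in \<open>auto simp: same_regs_def\<close>)
  \<comment> \<open>The invariant says that searching on from the current states with the remaining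
    digits gives the result of the whole search. This turns the recursion of \<open>search\<close>
    into a loop.\<close>
  let ?I = "\<lambda>i s'. same_regs {7..23} s s' \<and> search (k - i) (reg s' 7) (cell s') = search k t (reset (cell s)) \<and>
     acc s' = sum wt (deleted (cell s')) \<and> reg s' 7 \<le> m"
  have 3: "wp (For 9 (Reg 2) Digit) (\<lambda>s'. same_regs {7..23} s s' \<and> cell s' = search k t (reset (cell s)) \<and>
     acc s' = sum wt (deleted (cell s'))) (for_time k (digit_time n N m)) s2"
    if s2: "same_regs {7..23} s s2 \<and> cell s2 = reset (cell s) \<and> acc s2 = 0 \<and> reg s2 7 = t" for s2
  proof (rule wp_For[where I = ?I])
    show "?I 0 s2" using s2 s by (simp add: deleted_reset)
  next
    fix i s' assume i: "i < k" "?I i s'" "reg s' 9 = i"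
    have r: "reg s' 0 = n" "reg s' 1 = n * n" "reg s' 3 = N" using i s by (auto simp: same_regs_def)
    have ki: "k - i = Suc (k - Suc i)" using i(1) by simp
    have "reg s' 7 div N \<le> m" using i(2) div_le_dividend le_trans by blast
    note facts = this
    show "wp Digit (\<lambda>s''. reg s'' 9 = i \<and> ?I (Suc i) s'') (digit_time n N m) s'"
      by (rule wp_conseq[OF wp_Digit[OF r \<open>0 < N\<close> refl]]) (use i facts ki in \<open>auto simp: same_regs_def\<close>)
  qed (use s in \<open>auto simp: same_regs_def\<close>)
  show ?thesis unfolding Run_def run_time_def
    by (rule wp_then[OF wp_Reset[OF s(1,2)]], rule wp_then[OF 2], assumption, rule 3)
qed

lemma wp_Search:
  assumes s: "reg s 0 = n" "reg s 1 = n * n" "reg s 2 = k" "reg s 3 = N" "0 < N" "reg s 4 = m"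
  shows "wp Search (\<lambda>s'. reg s' 6 = (if \<exists>t<m. R 0 \<le> sum wt (deleted (search k t (reset (cell s)))) then 1 else 0))
     (search_time n k N m) s"
proof -
  let ?ok = "\<lambda>t. R 0 \<le> sum wt (deleted (search k t (reset (cell s))))"
  let ?I = "\<lambda>i s'. same_regs {5..23} s s' \<and> reset (cell s') = reset (cell s) \<and> reg s' 6 = (if \<exists>t<i. ?ok t then 1 else 0)"
  have "wp (For 5 (Reg 4) (Seq Run (Ite (RLess Acc (RLoad (NConst 0))) Skip (SetReg 6 (NConst 1)))))
     (\<lambda>s'. reg s' 6 = (if \<exists>t<m. ?ok t then 1 else 0)) (for_time m (run_time n k N m + 100)) (upd s 6 0)"
  proof (rule wp_For[where I = ?I])
    fix i s' assume i: "i < m" "?I i s'" "reg s' 5 = i"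
    have r: "reg s' 0 = n" "reg s' 1 = n * n" "reg s' 2 = k" "reg s' 3 = N" using i s by (auto simp: same_regs_def)
    show "wp (Seq Run (Ite (RLess Acc (RLoad (NConst 0))) Skip (SetReg 6 (NConst 1))))
       (\<lambda>s''. reg s'' 5 = i \<and> ?I (Suc i) s'') (run_time n k N m + 100) s'"
    proof (rule wp_then[OF wp_Run[OF r s(5) i(3) less_imp_le[OF i(1)]]])
      fix s'' assume a: "same_regs {7..23} s' s'' \<and> cell s'' = search k i (reset (cell s')) \<and> acc s'' = sum wt (deleted (cell s''))"
      have "acc s'' = sum wt (deleted (search k i (reset (cell s))))" "reset (cell s'') = reset (cell s)"
        using a i by (auto simp: reset_search) (auto simp: reset_def fun_eq_iff)
      note facts = this
      show "wp (Ite (RLess Acc (RLoad (NConst 0))) Skip (SetReg 6 (NConst 1)))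
         (\<lambda>s''. reg s'' 5 = i \<and> ?I (Suc i) s'') 100 s''"
        by (rule wp_straight, intro straight_rules, unfold bval.simps rval_0 rval_Acc)
          (use facts a i in \<open>auto simp: same_regs_def less_Suc_eq\<close>)
    qed
  qed (use s in \<open>auto simp: same_regs_def\<close>)
  note loop = this
  show ?thesis unfolding Search_def search_time_def
    by (rule wp_straight_Seq[where T = "for_time m (run_time n k N m + 100)"], rule straight_rules(4))
      (use loop in auto)
qed

lemma wp_Params:
  assumes s: "reg s 2 = k"
  shows "wp Params (\<lambda>s'. same_regs {3, 4, 9} s s' \<and> cell s' = cell s \<and> reg s' 3 = 4 * k\<^sup>2 + 1 \<and> reg s' 4 = 1)
     (for_time k 100 + 200) s"
proof -
  let ?I = "\<lambda>i s'. same_regs {3, 4, 9} s s' \<and> cell s' = cell s \<and> reg s' 3 = i * k"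
  have "wp (For 9 (Reg 2) (SetReg 3 (NAdd (Reg 3) (Reg 2)))) (?I k) (for_time k 100) (upd s 3 0)"
    by (rule wp_For[where I = ?I]; (rule wp_straight, intro straight_rules)?) (use s in \<open>auto simp: same_regs_def\<close>)
  note loop = this
  have "wp (Seq (For 9 (Reg 2) (SetReg 3 (NAdd (Reg 3) (Reg 2))))
     (Seq (SetReg 3 (NAdd (NAdd (NAdd (Reg 3) (Reg 3)) (NAdd (Reg 3) (Reg 3))) (NConst 1))) (SetReg 4 (NConst 1))))
     (\<lambda>s'. same_regs {3, 4, 9} s s' \<and> cell s' = cell s \<and> reg s' 3 = 4 * k\<^sup>2 + 1 \<and> reg s' 4 = 1) (for_time k 100 + 100) (upd s 3 0)"
    by (rule wp_then[OF loop]; (rule wp_straight, intro straight_rules)?) (auto simp: same_regs_def power2_eq_square)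
  note rest = this
  show ?thesis unfolding Params_def
    by (rule wp_straight_Seq[where T = "for_time k 100 + 100"], rule straight_rules(4)) (use rest in auto)
qed

lemma wp_Power:
  assumes s: "reg s 2 = k" "reg s 3 = N" "reg s 4 = 1"
  shows "wp Power (\<lambda>s'. same_regs {4, 9, 10, 22} s s' \<and> cell s' = cell s \<and> reg s' 4 = N ^ k)
     (for_time k (for_time N 100 + 200)) s"
proof -
  let ?S = "\<lambda>s'. same_regs {4, 9, 10, 22} s s' \<and> cell s' = cell s"
  show ?thesis unfolding Power_def
  proof (rule wp_For[where I = "\<lambda>i s'. ?S s' \<and> reg s' 4 = N ^ i"])
    fix i s' assume i: "?S s' \<and> reg s' 4 = N ^ i" "reg s' 9 = i"
    let ?I = "\<lambda>j s''. ?S s'' \<and> reg s'' 9 = i \<and> reg s'' 4 = N ^ i \<and> reg s'' 22 = j * N ^ i"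
    have inner: "wp (For 10 (Reg 3) (SetReg 22 (NAdd (Reg 22) (Reg 4)))) (?I N) (for_time N 100) (upd s' 22 0)"
      by (rule wp_For[where I = ?I]; (rule wp_straight, intro straight_rules)?) (use s i in \<open>auto simp: same_regs_def\<close>)
    have rest: "wp (Seq (For 10 (Reg 3) (SetReg 22 (NAdd (Reg 22) (Reg 4)))) (SetReg 4 (Reg 22)))
       (\<lambda>s''. reg s'' 9 = i \<and> ?S s'' \<and> reg s'' 4 = N ^ Suc i) (for_time N 100 + 100) (upd s' 22 0)"
      by (rule wp_then[OF inner]; (rule wp_straight, intro straight_rules)?) (auto simp: same_regs_def)
    show "wp (Seq (SetReg 22 (NConst 0)) (Seq (For 10 (Reg 3) (SetReg 22 (NAdd (Reg 22) (Reg 4)))) (SetReg 4 (Reg 22))))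
       (\<lambda>s''. reg s'' 9 = i \<and> ?S s'' \<and> reg s'' 4 = N ^ Suc i) (for_time N 100 + 200) s'"
      by (rule wp_straight_Seq[where T = "for_time N 100 + 100"], rule straight_rules(4)) (use rest in auto)
  qed (use s in \<open>auto simp: same_regs_def\<close>)
qed

lemma wp_Main_loop:
  assumes s: "reg s 0 = n" "reg s 1 = n * n" "reg s 2 = k" and N: "N = 4 * k\<^sup>2 + 1"
  shows "wp Main_loop (\<lambda>s'. reg s' 6 = (if \<exists>t<N ^ k. R 0 \<le> sum wt (deleted (search k t (reset (cell s)))) then 1 else 0))
     (main_time n k N) s"
  unfolding Main_loop_def main_time_def
proof (rule wp_then[OF wp_Params[OF s(3)]])
  fix s1 assume s1: "same_regs {3, 4, 9} s s1 \<and> cell s1 = cell s \<and> reg s1 3 = 4 * k\<^sup>2 + 1 \<and> reg s1 4 = 1"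
  have r1: "reg s1 2 = k" "reg s1 3 = N" "reg s1 4 = 1" using s1 s N by (auto simp: same_regs_def)
  show "wp (Seq Power Search) (\<lambda>s'. reg s' 6 = (if \<exists>t<N ^ k. R 0 \<le> sum wt (deleted (search k t (reset (cell s)))) then 1 else 0))
    (for_time k (for_time N 100 + 200) + search_time n k N (N ^ k)) s1"
  proof (rule wp_then[OF wp_Power[OF r1]])
    fix s2 assume s2: "same_regs {4, 9, 10, 22} s1 s2 \<and> cell s2 = cell s1 \<and> reg s2 4 = N ^ k"
    have r2: "reg s2 0 = n" "reg s2 1 = n * n" "reg s2 2 = k" "reg s2 3 = N" "0 < N" "reg s2 4 = N ^ k"
      using s1 s2 s N by (auto simp: same_regs_def)
    have c: "cell s2 = cell s" using s1 s2 by simp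
    show "wp Search (\<lambda>s'. reg s' 6 = (if \<exists>t<N ^ k. R 0 \<le> sum wt (deleted (search k t (reset (cell s)))) then 1 else 0))
      (search_time n k N (N ^ k)) s2"
      using wp_Search[OF r2] unfolding c .
  qed
qed

end

lemma runs_NStore:
  "m' = ((fst m)(nval a m := nval e m), snd m) \<Longrightarrow> t = 1 + ncost a + ncost e \<Longrightarrow> runs (NStore a e) m t m'"
  using runs.NStore by simp

text \<open>Stated for raw memories, because the layout described by \<open>mem\<close> exists only
  after this prelude.\<close>

lemma runs_Frame:
  assumes n: "2 \<le> n" and m: "fst m 0 = n" "fst m 2 = 0" "fst m (n + 3) = 0"
  shows "\<exists>t. runs Frame m t ((fst m)(2 := n, n + 3 := n * n, n * n + 2 := n, n * n + 3 := n * n,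
     n * n + 4 := fst m 1, 0 := n * n + 2), snd m) \<and> t \<le> 100 * n + 100"
proof -
  let ?M = "\<lambda>i. ((fst m)(2 := i, n + 3 := i * n), snd m)"
  let ?b = "NLess (NLoad (NConst 2)) (NLoad (NConst 0))"
  let ?A = "NLoad (NAdd (NLoad (NConst 0)) (NConst 3))"
  let ?p = "Seq (NStore (NAdd (NLoad (NConst 0)) (NConst 3)) (NAdd ?A (NLoad (NConst 0))))
     (NStore (NConst 2) (NAdd (NLoad (NConst 2)) (NConst 1)))"
  have body: "runs ?p (?M i) (13 + 6) (?M (Suc i))" for i
    by (rule runs.Seq[where m' = "((fst m)(2 := i, n + 3 := Suc i * n), snd m)"]; rule runs_NStore)
      (use m n in \<open>auto simp: fun_eq_iff\<close>)
  have loop: "\<exists>t. runs (While ?b ?p) (?M (n - d)) t (?M n) \<and> t \<le> d * 25 + 6" if "d \<le> n" for d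
    using that
  proof (induction d)
    case 0
    have "\<not> bval ?b (?M n)" using m n by auto
    from WhileFalse[OF this, of ?p]
    have "runs (While ?b ?p) (?M (n - 0)) (1 + bcost ?b) (?M n)" by (simp only: diff_zero)
    moreover have "1 + bcost ?b \<le> 0 * 25 + 6" by simp
    ultimately show ?case by blast
  next
    case (Suc d)
    then have "d \<le> n" by simp
    from Suc.IH[OF this] obtain t where t: "runs (While ?b ?p) (?M (n - d)) t (?M n)" "t \<le> d * 25 + 6" by blast
    have eq: "Suc (n - Suc d) = n - d" using Suc.prems by simp
    have "bval ?b (?M (n - Suc d))" using m n Suc.prems by auto
    from WhileTrue[OF this body[of "n - Suc d", unfolded eq] t(1)]
    have "runs (While ?b ?p) (?M (n - Suc d)) (1 + bcost ?b + (13 + 6) + t) (?M n)" .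
    moreover have "1 + bcost ?b + (13 + 6) + t \<le> Suc d * 25 + 6" using t(2) by simp
    ultimately show ?case by blast
  qed
  have m0: "?M 0 = m" using m n by (cases m) (auto simp: fun_eq_iff)
  \<comment> \<open>The scratch cell must stay below the frame: for \<open>n = 2\<close> the two
    addresses are 5 and 6.\<close>
  have "n * 2 \<le> n * n" using n by (rule mult_le_mono2)
  then have big: "n + 3 < n * n + 2" using n by linarith
  obtain t where t: "runs (While ?b ?p) m t (?M n)" "t \<le> n * 25 + 6"
    using loop[of n, unfolded diff_self_eq_0 m0] by blast
  let ?M1 = "((fst m)(2 := n, n + 3 := n * n, n * n + 2 := n), snd m)"
  let ?M2 = "((fst m)(2 := n, n + 3 := n * n, n * n + 2 := n, n * n + 3 := n * n), snd m)"
  let ?M3 = "((fst m)(2 := n, n + 3 := n * n, n * n + 2 := n, n * n + 3 := n * n, n * n + 4 := fst m 1), snd m)"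
  let ?M4 = "((fst m)(2 := n, n + 3 := n * n, n * n + 2 := n, n * n + 3 := n * n, n * n + 4 := fst m 1,
     0 := n * n + 2), snd m)"
  have 1: "runs (NStore (NAdd ?A (NConst 2)) (NLoad (NConst 0))) (?M n) 10 ?M1"
    by (rule runs_NStore) (use m n in simp_all)
  have 2: "runs (NStore (NAdd ?A (NConst 3)) ?A) ?M1 13 ?M2"
    by (rule runs_NStore) (use m n big in simp_all)
  have 3: "runs (NStore (NAdd ?A (NConst 4)) (NLoad (NConst 1))) ?M2 10 ?M3"
    by (rule runs_NStore) (use m n big in simp_all)
  have 4: "runs (NStore (NConst 0) (NAdd ?A (NConst 2))) ?M3 9 ?M4"
    by (rule runs_NStore) (use m n big in simp_all)
  have "runs Frame m (t + (10 + (13 + (10 + 9)))) ?M4"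
    unfolding Frame_def by (intro runs.Seq[OF t(1)] runs.Seq[OF 1] runs.Seq[OF 2] runs.Seq[OF 3] 4)
  moreover have "t + (10 + (13 + (10 + 9))) \<le> 100 * n + 100" using t(2) by simp
  ultimately show ?thesis by blast
qed

section \<open>Running time\<close>

lemma connected_time_le:
  assumes "1 \<le> n" shows "connected_time n \<le> 90000 * n ^ 3"
proof -
  have "n ^ 1 \<le> n ^ 3" using assms by (intro power_increasing) auto
  moreover have "connected_time n = 400 + 612 * n + 500 * n ^ 3"
    unfolding connected_time_def cells_time_def for_time_def by (simp add: power3_eq_cube algebra_simps)
  ultimately show ?thesis using assms by simp
qed

lemma biconnected_time_le:
  assumes "1 \<le> n" shows "biconnected_time n \<le> 190000 * n ^ 4"
proof -
  have "1 \<le> n ^ 3" using assms by (simp add: Suc_leI)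
  have "(n + 1) * (connected_time n + 100) \<le> (n + 1) * (90000 * n ^ 3 + 100)"
    using connected_time_le[OF assms] by (intro mult_le_mono) auto
  then have "biconnected_time n \<le> 106 + (n + 1) * (90000 * n ^ 3 + 100)"
    unfolding biconnected_time_def for_time_def by linarith
  also have "\<dots> \<le> 106 * (n * n ^ 3) + (n + n) * (90000 * n ^ 3 + 100 * n ^ 3)"
    using \<open>1 \<le> n ^ 3\<close> assms by (intro add_mono mult_le_mono) (auto simp: Suc_leI)
  also have "\<dots> = 180306 * n ^ 4" using power_Suc[of n 3] by (simp add: algebra_simps)
  also have "\<dots> \<le> 190000 * n ^ 4" by simp
  finally show ?thesis .
qed

text \<open>Origin of the degree 6: a sweep visits \<open>n * n\<close> cells, a test makes
  \<open>n\<close> sweeps for each of \<open>n + 1\<close> values of the deleted vertex, and a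
  choice tests up to \<open>n * n\<close> cells. The constants are rounded up generously.\<close>

lemma pick_time_le:
  assumes "1 \<le> n" shows "pick_time n \<le> 200000 * n ^ 6"
proof -
  have "1 \<le> n ^ 4" "1 \<le> n ^ 6" using assms by (simp_all add: Suc_leI)
  have "n ^ 2 * (biconnected_time n + 400) \<le> n ^ 2 * (190000 * n ^ 4 + 400)"
    using biconnected_time_le[OF assms] by (intro mult_le_mono) auto
  moreover have "pick_time n = 132 + n ^ 2 * (biconnected_time n + 400)"
    unfolding pick_time_def cells_time_def for_time_def by (simp add: power2_eq_square algebra_simps)
  ultimately have "pick_time n \<le> 132 + n ^ 2 * (190000 * n ^ 4 + 400)" by linarith
  also have "\<dots> \<le> 132 * n ^ 6 + n ^ 2 * (190000 * n ^ 4 + 400 * n ^ 4)"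
    using \<open>1 \<le> n ^ 4\<close> \<open>1 \<le> n ^ 6\<close> by (intro add_mono mult_le_mono) auto
  also have "\<dots> = 190532 * n ^ 6" by (simp add: algebra_simps flip: power_add)
  finally show ?thesis by simp
qed

lemma digit_time_le:
  assumes "1 \<le> n" shows "digit_time n N m \<le> 300000 * (n ^ 6 * (m + N + 1))"
proof -
  define p where "p = n ^ 6"
  have p: "1 \<le> p" using assms by (simp add: p_def Suc_leI)
  have mp: "m \<le> p * m" "N \<le> p * N" using p by (simp_all add: Suc_leI)
  have "N * (pick_time n + 200) \<le> N * (200200 * p)"
    using pick_time_le[OF assms] p by (intro mult_le_mono) (auto simp: p_def)
  moreover have "pick_time n \<le> 200000 * p" using pick_time_le[OF assms] by (simp add: p_def)
  ultimately have "digit_time n N m \<le> 200 * m + 130 + (N * (200200 * p) + 100 + (200000 * p + 200))"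
    unfolding digit_time_def for_time_def by (simp add: algebra_simps)
  also have "\<dots> = 200 * m + 430 + 200200 * (p * N) + 200000 * p" by simp
  also have "\<dots> \<le> 300000 * (p * m) + 300000 * (p * N) + 300000 * p" using p mp by linarith
  also have "\<dots> = 300000 * (p * (m + N + 1))" by (simp add: algebra_simps)
  finally show ?thesis by (simp add: p_def)
qed

lemma run_time_le:
  assumes "1 \<le> n" shows "run_time n k N m \<le> 400000 * (n ^ 6 * ((k + 1) * (m + N + 1)))"
proof -
  define q where "q = n ^ 6 * (m + N + 1)"
  have q1: "1 \<le> q" using assms by (simp add: q_def Suc_leI)
  have "n ^ 2 * 1 \<le> n ^ 6 * (m + N + 1)" using assms by (intro mult_le_mono power_increasing) auto
  then have q2: "n * n \<le> q" by (simp add: q_def power2_eq_square)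
  have "k * (digit_time n N m + 100) \<le> k * (300100 * q)"
    using digit_time_le[OF assms, of N m] q1 by (intro mult_le_mono) (auto simp: q_def)
  then have "run_time n k N m \<le> (300 * (n * n) + 112) + (200 + k * (300100 * q))"
    unfolding run_time_def cells_time_def for_time_def by (simp add: algebra_simps)
  also have "\<dots> = 300 * (n * n) + 312 + 300100 * (q * k)" by simp
  also have "\<dots> \<le> 400000 * (q * k) + 400000 * q" using q1 q2 by linarith
  also have "\<dots> = 400000 * (q * (k + 1))" by (simp add: algebra_simps)
  finally show ?thesis by (simp add: q_def algebra_simps)
qed

text \<open>The summand \<open>100 * n + 107\<close> accounts for \<open>Frame\<close> and for the
  final store of the answer, which takes 7 units.\<close>

lemma main_time_le:
  assumes "1 \<le> n"
  shows "100 * n + 107 + main_time n k N \<le> 2000000 * (n ^ 6 * ((N ^ k + 1) * ((k + 1) * (N ^ k + N + 1))))"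
proof -
  define m where "m = N ^ k"
  define q where "q = n ^ 6 * ((k + 1) * (m + N + 1))"
  have n6: "1 \<le> n ^ 6" using assms by (simp add: Suc_leI)
  have "n ^ 1 * 1 \<le> n ^ 6 * ((k + 1) * (m + N + 1))" using assms by (intro mult_le_mono power_increasing) auto
  then have nq: "n \<le> q" by (simp add: q_def)
  have "1 * ((k + 1) * (N + 1)) \<le> n ^ 6 * ((k + 1) * (m + N + 1))" using n6 by (intro mult_le_mono) auto
  then have kq: "k * N + k + N + 1 \<le> q" by (simp add: q_def algebra_simps)
  have "m * (run_time n k N m + 200) \<le> m * (400200 * q)"
    using run_time_le[OF assms, of k N m] nq assms by (intro mult_le_mono) (auto simp: q_def)
  then have "100 * n + 107 + main_time n k N \<le> 100 * n + 107 + (200 * k + 300 + (200 * (k * N) + 400 * k + 100 + (106 + m * (400200 * q))))"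
    unfolding main_time_def search_time_def for_time_def m_def[symmetric] by (simp add: algebra_simps)
  also have "\<dots> = 100 * n + 613 + 600 * k + 200 * (k * N) + 400200 * (q * m)" by simp
  also have "\<dots> \<le> 2000000 * (q * m) + 2000000 * q" using nq kq by linarith
  also have "\<dots> = 2000000 * (q * (m + 1))" by (simp add: algebra_simps)
  finally show ?thesis by (simp add: q_def m_def algebra_simps)
qed

text \<open>The binary logarithm of the factor that depends on \<open>k\<close>, with
  \<open>N = 4 * k\<^sup>2 + 1\<close>. The exponent \<open>2 * k\<close> combines the
  \<open>N ^ k\<close> branches with the cost of decoding each of them.\<close>

definition log_time :: "nat \<Rightarrow> real" where
  "log_time k = (ln 12000000 + 2 * real k * ln (4 * (real k)\<^sup>2 + 1) + ln (real k + 1)) / ln 2"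

lemma log_time_bigo: "log_time \<in> O(\<lambda>k. real k * ln (real k))"
  unfolding log_time_def by real_asymp

lemma powr_log_time: "2 powr log_time k = 12000000 * (4 * (real k)\<^sup>2 + 1) ^ (2 * k) * (real k + 1)"
proof -
  have pos: "0 < 4 * (real k)\<^sup>2 + 1" by (simp add: add_nonneg_pos)
  have "2 powr log_time k = exp (ln 12000000 + real (2 * k) * ln (4 * (real k)\<^sup>2 + 1) + ln (real k + 1))"
    by (simp add: powr_def log_time_def)
  also have "\<dots> = exp (ln 12000000) * exp (ln (4 * (real k)\<^sup>2 + 1)) ^ (2 * k) * exp (ln (real k + 1))"
    by (simp only: exp_add exp_of_nat_mult)
  also have "\<dots> = 12000000 * (4 * (real k)\<^sup>2 + 1) ^ (2 * k) * (real k + 1)"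
    using pos by (simp only: exp_ln)
  finally show ?thesis .
qed

lemma main_time_le_powr:
  assumes "1 \<le> n" and N: "N = 4 * k\<^sup>2 + 1"
  shows "real (100 * n + 107 + main_time n k N) \<le> 2 powr log_time k * real n ^ 6"
proof -
  have N1: "1 \<le> N ^ k" using N by (simp add: Suc_leI)
  \<comment> \<open>For \<open>k = 0\<close> this holds only because \<open>N\<close> is then
    1.\<close>
  have "N \<le> N ^ k"
  proof (cases "k = 0")
    case True
    then show ?thesis using N by simp
  next
    case False
    then show ?thesis using N by (intro self_le_power) auto
  qed
  then have "N ^ k + N + 1 \<le> 3 * N ^ k" using N1 by linarith
  then have "(N ^ k + 1) * ((k + 1) * (N ^ k + N + 1)) \<le> (2 * N ^ k) * ((k + 1) * (3 * N ^ k))"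
    using N1 by (intro mult_le_mono) auto
  also have "\<dots> = 6 * (N ^ (2 * k) * (k + 1))" by (simp add: power_mult power2_eq_square algebra_simps flip: power_mult_distrib)
  finally have "n ^ 6 * ((N ^ k + 1) * ((k + 1) * (N ^ k + N + 1))) \<le> n ^ 6 * (6 * (N ^ (2 * k) * (k + 1)))"
    by (rule mult_le_mono2)
  then have "100 * n + 107 + main_time n k N \<le> 12000000 * N ^ (2 * k) * (k + 1) * n ^ 6"
    using main_time_le[OF assms(1), of k N] by (simp add: algebra_simps)
  then have "real (100 * n + 107 + main_time n k N) \<le> real (12000000 * N ^ (2 * k) * (k + 1) * n ^ 6)"
    by (rule of_nat_mono)
  also have "\<dots> = 2 powr log_time k * real n ^ 6"
    unfolding powr_log_time N by (simp add: add.commute distrib_left)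
  finally show ?thesis .
qed

lemma Program_correct:
  assumes "wbd_instance n E k wstar w"
  shows "answers_within Program (wbd_input n E k wstar w) (wbd_yes n E k wstar w) (2 powr log_time k * real n ^ 6)"
proof -
  let ?in = "wbd_input n E k wstar w"
  \<comment> \<open>Reading the weights from memory makes the locale assumption \<open>wt_R\<close>
    immediate; agreement with \<open>w\<close> is shown later, for edges.\<close>
  define wt where "wt = (\<lambda>i. snd ?in (Suc i))"
  define N where "N = 4 * k\<^sup>2 + 1"
  have sg: "simple_graph {..<n} E" and bi: "biconnected {..<n} E" and w: "\<And>e. e \<in> E \<Longrightarrow> 0 \<le> w e"
    using assms by (auto simp: wbd_instance_def)
  have n: "2 \<le> n" using bi by (simp add: biconnected_def)
  interpret ram n wt N k "snd ?in" by unfold_locales (use n in \<open>auto simp: wt_def\<close>)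
  \<comment> \<open>The state that \<open>Frame\<close> leaves behind: its two scratch cells on the
    diagonal still hold \<open>n\<close> and \<open>n * n\<close>.\<close>
  define s where "s = \<lparr>reg = (\<lambda>_. 0)(0 := n, 1 := n * n, 2 := k), mark = (\<lambda>_. 0),
    cell = (\<lambda>i. if i = 0 then n else if i = n + 1 then n * n
      else if i < n * n \<and> {i div n, i mod n} \<in> E then 1 else 0), acc = 0\<rparr>"
  have "n * 2 \<le> n * n" using n by (rule mult_le_mono2)
  then have big: "n + 3 < n * n + 2" using n by linarith
  \<comment> \<open>A diagonal entry stands for \<open>{a, a} = {a}\<close>, so the scratch cells
    contain 0 at the start, as \<open>Frame\<close> expects.\<close>
  have loop_free: "{a} \<notin> E" for a using sg by (auto simp: simple_graph_def)
  have d: "(n + 1) div n = 1" "(n + 1) mod n = 1" using n by (simp_all add: div_Suc mod_Suc)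
  have in_cells: "fst ?in 0 = n" "fst ?in 2 = 0" "fst ?in (n + 3) = 0" "fst ?in 1 = k"
    using loop_free d n by (auto simp: wbd_input_def)
  have mem_s: "((fst ?in)(2 := n, n + 3 := n * n, n * n + 2 := n, n * n + 3 := n * n,
     n * n + 4 := fst ?in 1, 0 := n * n + 2), snd ?in) = mem s"
  proof -
    have fm: "fst (mem s) a = (if a = 0 then n * n + 2 else if a = 1 then k
        else if a < n * n + 2 then if a = 2 then n else if a = n + 3 then n * n
          else if a - 2 < n * n \<and> {(a - 2) div n, (a - 2) mod n} \<in> E then 1 else 0
        else if a = n * n + 2 then n else if a = n * n + 3 then n * n else if a = n * n + 4 then k else 0)" for a
    proof -
      consider "a = 0" | "a = 1" | "a = 2" | "a = n + 3" | "2 < a" "a \<noteq> n + 3" "a < n * n + 2" | "n * n + 2 \<le> a"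
        by linarith
      then show ?thesis
      proof cases
        case 5
        then have "a - 2 \<noteq> 0" "a - 2 \<noteq> n + 1" by linarith+
        then show ?thesis using 5 by (simp add: mem_def base_def s_def)
      next
        case 6
        define j where "j = a - (n * n + 2)"
        have "a = n * n + 2 + j" using 6 by (simp add: j_def)
        then show ?thesis by (simp add: mem_def base_def s_def)
      qed (use big n in \<open>simp_all add: mem_def base_def s_def\<close>)
    qed
    have fi: "fst ?in a = (if a = 0 then n else if a = 1 then k
        else if a - 2 < n * n \<and> {(a - 2) div n, (a - 2) mod n} \<in> E then 1 else 0)" for a
      by (simp add: wbd_input_def)
    have sm: "snd (mem s) a = (if a = n * n + 2 then 0 else snd ?in a)" for a
      by (simp add: mem_def base_def s_def)
    have "fst (mem s) = (fst ?in)(2 := n, n + 3 := n * n, n * n + 2 := n, n * n + 3 := n * n,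
       n * n + 4 := fst ?in 1, 0 := n * n + 2)"
      using big n by (intro ext) (auto simp: fm fi)
    moreover have "snd (mem s) = snd ?in" unfolding fun_eq_iff sm by (simp add: wbd_input_def)
    ultimately show ?thesis by (simp add: prod_eq_iff)
  qed
  obtain t1 where t1: "runs Frame ?in t1 (mem s)" "t1 \<le> 100 * n + 100"
    using runs_Frame[OF n in_cells(1-3)] unfolding mem_s by blast
  have "wp Main_loop (\<lambda>s'. reg s' 6 = (if \<exists>t<N ^ k. snd ?in 0 \<le> sum wt (deleted (search k t (reset (cell s)))) then 1 else 0))
     (main_time n k N) s"
    by (rule wp_Main_loop) (simp_all add: s_def N_def)
  then obtain t2 s' where t2: "runs Main_loop (mem s) t2 (mem s')" "t2 \<le> main_time n k N"
    "reg s' 6 = (if \<exists>t<N ^ k. snd ?in 0 \<le> sum wt (deleted (search k t (reset (cell s)))) then 1 else 0)"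
    unfolding wp_def by blast
  have yes: "wbd_yes n E k wstar w \<longleftrightarrow> (\<exists>t<N ^ k. wstar \<le> sum wt (deleted (search k t (reset (cell s)))))"
  proof (rule yes_iff_search[OF sg bi])
    show "4 * k\<^sup>2 < N" by (simp add: N_def)
    fix i assume i: "upper i"
    have "i \<noteq> 0" using i by (metis upper_def div_0 mod_0 less_irrefl)
    moreover have "i \<noteq> n + 1" using i d by (auto simp: upper_def)
    ultimately show "reset (cell s) i = (if edge i \<in> E then 1 else 0)"
      using i by (simp add: reset_def s_def upper_def edge_def)
    assume "edge i \<in> E"
    then show "wt i = w (edge i)" using i by (simp add: wt_def wbd_input_def upper_def edge_def)
  qed (rule w)
  have "snd ?in 0 = wstar" by (simp add: wbd_input_def)
  with t2(3) yes have ans: "reg s' 6 = (if wbd_yes n E k wstar w then 1 else 0)" by simp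
  let ?m = "((fst (mem s'))(0 := reg s' 6), snd (mem s'))"
  have "runs (NStore (NConst 0) (Reg 6)) (mem s') 7 ?m" by (rule runs_NStore) simp_all
  then have r: "runs Program ?in (t1 + (t2 + 7)) ?m"
    unfolding Program_def by (intro runs.Seq[OF t1(1)] runs.Seq[OF t2(1)])
  have "real (t1 + (t2 + 7)) \<le> real (100 * n + 107 + main_time n k N)"
    using t1(2) t2(2) by (intro of_nat_mono) linarith
  also have "\<dots> \<le> 2 powr log_time k * real n ^ 6"
    by (rule main_time_le_powr) (use n in \<open>simp_all add: N_def\<close>)
  finally show ?thesis unfolding answers_within_def using r ans
    by (intro exI[of _ "t1 + (t2 + 7)"] exI[of _ ?m]) simp
qed

theorem theorem1:
  "\<exists>(p :: com) (f :: nat \<Rightarrow> real) (c :: nat).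
     f \<in> O(\<lambda>k. real k * ln (real k)) \<and>
     (\<forall>(n :: nat) (E :: nat set set) (k :: nat) (wstar :: real) (w :: nat set \<Rightarrow> real).
        wbd_instance n E k wstar w \<longrightarrow>
        answers_within p (wbd_input n E k wstar w) (wbd_yes n E k wstar w)
          (2 powr f k * real n ^ c))"
  using log_time_bigo Program_correct by blast

end
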